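(* Let $(W_h,V_h)$ be the broken and unbroken finite-dimensional complexes described in the context, let $0\le k\le n$ and $f\in L^2\Lambda^k(\Omega)$. Consider the hybrid problem: find $\sigma_h\in W_h^{k-1}$, $u_h\in W_h^k$, $\bar p_h\in\overline{\mathfrak H}_h^k$, $\hat u_h^{\mathrm{nor}}\in\widehat W_h^{k-1,\mathrm{nor}}$, $\hat\rho_h^{\mathrm{nor}}\in\widehat W_h^{k,\mathrm{nor}}$, $p_h\in\mathfrak H_h^k$, $\bar u_h\in\overline{\mathfrak H}_h^k$, $\hat\sigma_h^{\mathrm{tan}}\in\widehat V_h^{k-1,\mathrm{tan}}$, $\hat u_h^{\mathrm{tan}}\in\widehat V_h^{k,\mathrm{tan}}$ such that (a) $(\sigma_h,\tau_h)_{\mathcal T_h}-(u_h,\mathrm d\tau_h)_{\mathcal T_h}+\langle\hat u_h^{\mathrm{nor}},\tau_h^{\mathrm{tan}}\rangle_{\partial\mathcal T_h}=0$ for all $\tau_h\in W_h^{k-1}$; (b) $(\mathrm d\sigma_h,v_h)_{\mathcal T_h}+(\mathrm du_h,\mathrm dv_h)_{\mathcal T_h}+(\bar p_h+p_h,v_h)_{\mathcal T_h}-\langle\hat\rho_h^{\mathrm{nor}},v_h^{\mathrm{tan}}\rangle_{\partial\mathcal T_h}=(f,v_h)_{\mathcal T_h}$ for all $v_h\in W_h^k$; (c) $(\bar u_h-u_h,\bar q_h)_{\mathcal T_h}=0$ for all $\bar q_h\in\overline{\mathfrak H}_h^k$; (d) $\langle\hat\sigma_h^{\mathrm{tan}}-\sigma_h^{\mathrm{tan}},\hat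 v_h^{\mathrm{nor}}\rangle_{\partial\mathcal T_h}=0$ for all $\hat v_h^{\mathrm{nor}}\in\widehat W_h^{k-1,\mathrm{nor}}$; (e) $\langle\hat u_h^{\mathrm{tan}}-u_h^{\mathrm{tan}},\hat\eta_h^{\mathrm{nor}}\rangle_{\partial\mathcal T_h}=0$ for all $\hat\eta_h^{\mathrm{nor}}\in\widehat W_h^{k,\mathrm{nor}}$; (f) $(u_h,q_h)_{\mathcal T_h}=0$ for all $q_h\in\mathfrak H_h^k$; (g) $(\bar p_h,\bar v_h)_{\mathcal T_h}=0$ for all $\bar v_h\in\overline{\mathfrak H}_h^k$; (h) $\langle\hat u_h^{\mathrm{nor}},\hat\tau_h^{\mathrm{tan}}\rangle_{\partial\mathcal T_h}=0$ for all $\hat\tau_h^{\mathrm{tan}}\in\widehat V_h^{k-1,\mathrm{tan}}$; (i) $\langle\hat\rho_h^{\mathrm{nor}},\hat v_h^{\mathrm{tan}}\rangle_{\partial\mathcal T_h}=0$ for all $\hat v_h^{\mathrm{tan}}\in\widehat V_h^{k,\mathrm{tan}}$. Then the following are equivalent: 1. $(\sigma_h,u_h,\bar p_h,\hat u_h^{\mathrm{nor}},\hat\rho_h^{\mathrm{nor}},p_h,\bar u_h,\hat\sigma_h^{\mathrm{tan}},\hat u_h^{\mathrm{tan}})$ is a solution to (a)--(i). 2. $(\sigma_h,u_h,p_h)\in V_h^{k-1}\times V_h^k\times\mathfrak H_h^k$ is a solution of the FEEC problem $$(\sigma_h,\tau_h)_\Omega-(u_h,\mathrm d\tau_h)_\Omega=0\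 \ \forall\tau_h\in V_h^{k-1},$$ $$(\mathrm d\sigma_h,v_h)_\Omega+(\mathrm du_h,\mathrm dv_h)_\Omega+(p_h,v_h)_\Omega=(f,v_h)_\Omega\ \ \forall v_h\in V_h^k,$$ $$(u_h,q_h)_\Omega=0\ \ \forall q_h\in\mathfrak H_h^k,$$ and furthermore $\bar p_h=0$, $\hat u_h^{\mathrm{nor}}$ and $\hat\rho_h^{\mathrm{nor}}$ are uniquely determined by (a)--(b), $\bar u_h$ is the $L^2$-orthogonal projection of $u_h$ onto $\overline{\mathfrak H}_h^k$, $\hat\sigma_h^{\mathrm{tan}}=\sigma_h^{\mathrm{tan}}$, and $\hat u_h^{\mathrm{tan}}=u_h^{\mathrm{tan}}$.
   Context: Function spaces. $\Omega\subset\mathbb R^n$ is a bounded Lipschitz domain. $L^2\Lambda^k(\Omega)$ is the space of $L^2$ differential $k$-forms with inner product $(v,w)_\Omega=\int_\Omega v\wedge\star w$; $\mathrm d$ is the (distributional) exterior derivative and $\delta=(-1)^k\star^{-1}\mathrm d\star$ the codifferential on $k$-forms. $H\Lambda^k(\Omega)=\{v\in L^2\Lambda^k:\mathrm dv\in L^2\}$, $H^*\Lambda^k(\Omega)=\{v\in L^2\Lambda^k:\delta v\in L^2\}$ with graph norms; $\mathring H\Lambda^k(\Omega)$, $\mathring H^*\Lambda^k(\Omega)$ are the closures of the smooth compactly supported $k$-forms. Spaces of forms of degree outside $\{0,\dots,n\}$ are zero. The same notation is used on any Lipschitz subdomain $K$. Traces. The tangential trace $v^{\mathrm{tan}}$ of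 $v\in H\Lambda^k(K)$ is (identified with) its class in $H\Lambda^k(K)/\mathring H\Lambda^k(K)$; for smooth forms it is the pullback of $v$ to $\partial K$. Decomposition. $\mathcal T_h$ is a finite decomposition of $\Omega$ into non-overlapping Lipschitz subdomains $K$. $(\cdot,\cdot)_{\mathcal T_h}=\sum_K(\cdot,\cdot)_K$; $\mathrm d$ and tangential traces of broken forms (elements of $H\Lambda^k(\mathcal T_h)=\prod_K H\Lambda^k(K)$) are taken subdomain by subdomain. $H\Lambda^k(\Omega)$ is regarded as a subspace of $H\Lambda^k(\mathcal T_h)$ by restriction. Discrete spaces. For each $K\in\mathcal T_h$, $W_h(K)\subset H\Lambda(K)$ is a finite-dimensional subcomplex (finite-dimensional $W_h^j(K)\subset H\Lambda^j(K)$ with $\mathrm dW_h^j(K)\subset W_h^{j+1}(K)$). $W_h^j=\prod_KW_h^j(K)$ and $V_h^j=H\Lambda^j(\Omega)\cap W_h^j$. $\mathring W_h^j(K)=W_h^j(K)\cap\mathring H\Lambda^j(K)$. Local discrete harmonic forms: $\mathring{\mathfrak H}_h^k(K)=\{v\in\mathring W_h^k(K):\mathrm dv=0,\ v\perp_{L^2}\mathrm d\mathring W_h^{k-1}(K)\}$, and $\overline{\mathfrak H}_h^k=\prod_K\mathring{\mathfrak H}_h^k(K)$. Global discrete harmonic forms: $\mathfrak H_h^k=\{v\in V_h^k:\mathrm dv=0,\ v\perp_{L^2}\mathrm dV_h^{k-1}\}$. Trace spaces: $\widehat W_h^{j,\mathrm{tan}}=\{v_h^{\mathrm{tan}}:v_h\in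 W_h^j\}$, $\widehat V_h^{j,\mathrm{tan}}=\{v_h^{\mathrm{tan}}:v_h\in V_h^j\}$ (traces on $\partial\mathcal T_h=\bigsqcup_K\partial K$), and $\widehat W_h^{j,\mathrm{nor}}=(\widehat W_h^{j,\mathrm{tan}})^*$ is the dual space; $\langle\cdot,\cdot\rangle_{\partial\mathcal T_h}$ denotes the duality pairing between $\widehat W_h^{j,\mathrm{tan}}$ and $\widehat W_h^{j,\mathrm{nor}}$ (written in either order). *)

theory Defs
  imports "HOL-Analysis.Analysis"
begin

section \<open>Square-integrable functions modulo null sets\<close>

definition square_integrable :: "('a::euclidean_space \<Rightarrow> 'b::euclidean_space) \<Rightarrow> bool" where
  "square_integrable f \<longleftrightarrow>
     f \<in> borel_measurable lebesgue \<and> integrable lebesgue (\<lambda>x. (norm (f x))\<^sup>2)"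

definition l2_rel :: "('a::euclidean_space \<Rightarrow> 'b::euclidean_space) \<Rightarrow> ('a \<Rightarrow> 'b) \<Rightarrow> bool" where
  "l2_rel f g \<longleftrightarrow>
     square_integrable f \<and> square_integrable g \<and> (AE x in lebesgue. f x = g x)"

lemma square_integrable_zero: "square_integrable (\<lambda>x. 0)"
  by (simp add: square_integrable_def)

lemma square_integrable_scaleR:
  assumes "square_integrable f"
  shows "square_integrable (\<lambda>x. c *\<^sub>R f x)"
  using assms unfolding square_integrable_def
  by (auto simp: power_mult_distrib intro!: borel_measurable_scaleR)

lemma square_integrable_add:
  assumes f: "square_integrable f" and g: "square_integrable g"
  shows "square_integrable (\<lambda>x. f x + g x)"
proof -
  have m: "(\<lambda>x. f x + g x) \<in> borel_measurable lebesgue"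
    using f g unfolding square_integrable_def by (intro borel_measurable_add) auto
  have i: "integrable lebesgue (\<lambda>x. 2 * (norm (f x))\<^sup>2 + 2 * (norm (g x))\<^sup>2)"
    using f g unfolding square_integrable_def by simp
  have le: "(norm (f x + g x))\<^sup>2 \<le> 2 * (norm (f x))\<^sup>2 + 2 * (norm (g x))\<^sup>2" for x
  proof -
    have "(norm (f x + g x))\<^sup>2 \<le> (norm (f x) + norm (g x))\<^sup>2"
      by (intro power_mono norm_triangle_ineq) auto
    also have "\<dots> \<le> 2 * (norm (f x))\<^sup>2 + 2 * (norm (g x))\<^sup>2"
      using sum_squares_bound[of "norm (f x)" "norm (g x)"] by (simp add: power2_sum)
    finally show ?thesis .
  qed
  have "integrable lebesgue (\<lambda>x. (norm (f x + g x))\<^sup>2)"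
    by (rule Bochner_Integration.integrable_bound[OF i]) (use m le in \<open>auto intro!: AE_I2\<close>)
  with m show ?thesis by (simp add: square_integrable_def)
qed

lemma square_integrable_uminus: "square_integrable f \<Longrightarrow> square_integrable (\<lambda>x. - f x)"
  using square_integrable_scaleR[of f "-1"] by simp

lemma square_integrable_diff:
  "square_integrable f \<Longrightarrow> square_integrable g \<Longrightarrow> square_integrable (\<lambda>x. f x - g x)"
  using square_integrable_add[of f "\<lambda>x. - g x"] square_integrable_uminus[of g] by simp

quotient_type (overloaded) ('a, 'b) l2 =
  "'a::euclidean_space \<Rightarrow> 'b::euclidean_space" / partial: "l2_rel"
proof (rule part_equivpI)
  show "\<exists>f :: 'a \<Rightarrow> 'b. l2_rel f f"
    by (rule exI[of _ "\<lambda>x. 0"]) (simp add: l2_rel_def square_integrable_zero)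
  show "symp (l2_rel :: ('a \<Rightarrow> 'b) \<Rightarrow> _)"
    by (rule sympI) (auto simp: l2_rel_def elim: AE_mp)
  show "transp (l2_rel :: ('a \<Rightarrow> 'b) \<Rightarrow> _)"
  proof (rule transpI)
    fix f g h :: "'a \<Rightarrow> 'b"
    assume "l2_rel f g" "l2_rel g h"
    then show "l2_rel f h" unfolding l2_rel_def by (auto elim: AE_mp)
  qed
qed

instantiation l2 :: (euclidean_space, euclidean_space) real_vector
begin

lift_definition zero_l2 :: "('a, 'b) l2" is "\<lambda>x. 0"
  by (simp add: l2_rel_def square_integrable_zero)

lift_definition plus_l2 :: "('a, 'b) l2 \<Rightarrow> ('a, 'b) l2 \<Rightarrow> ('a, 'b) l2" is "\<lambda>f g x. f x + g x"
  unfolding l2_rel_def by (auto intro: square_integrable_add elim: AE_mp)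

lift_definition minus_l2 :: "('a, 'b) l2 \<Rightarrow> ('a, 'b) l2 \<Rightarrow> ('a, 'b) l2" is "\<lambda>f g x. f x - g x"
  unfolding l2_rel_def by (auto intro: square_integrable_diff elim: AE_mp)

lift_definition uminus_l2 :: "('a, 'b) l2 \<Rightarrow> ('a, 'b) l2" is "\<lambda>f x. - f x"
  unfolding l2_rel_def by (auto intro: square_integrable_uminus elim: AE_mp)

lift_definition scaleR_l2 :: "real \<Rightarrow> ('a, 'b) l2 \<Rightarrow> ('a, 'b) l2" is "\<lambda>c f x. c *\<^sub>R f x"
  unfolding l2_rel_def by (auto intro: square_integrable_scaleR elim: AE_mp)

instance
  by standard
    (transfer, auto simp: l2_rel_def algebra_simps
       intro: square_integrable_add square_integrable_diff square_integrable_uminus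
              square_integrable_scaleR square_integrable_zero)+

end


section \<open>Exterior algebra and differential forms\<close>

text \<open>
  An element \<open>a\<close> of the exterior algebra of \<open>\<real>\<^sup>n\<close> is given by its coefficients:
  \<open>a $ I\<close> is the coefficient of \<open>dx\<^sub>I = dx\<^sub>i\<^sub>1 \<and> \<dots> \<and> dx\<^sub>i\<^sub>k\<close>, where \<open>i\<^sub>1 < \<dots> < i\<^sub>k\<close> enumerate \<open>I\<close>.
  A form is a class of square-integrable such fields on the whole space; forms on a
  domain \<open>K\<close> are those vanishing almost everywhere outside \<open>K\<close> (extension by zero).
  Degrees are integers, so that forms of degree outside \<open>{0..n}\<close> are zero.
\<close>

type_synonym 'n domain = "(real^'n) set"

type_synonym 'n form = "(real^'n, real^('n set)) l2"

text \<open>\<open>dx\<^sub>I \<and> dx\<^sub>J = shuffle_sign I J dx\<^sub>I\<^sub>\<union>\<^sub>J\<close> for disjoint \<open>I\<close>, \<open>J\<close>.\<close>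

definition shuffle_sign :: "'n::{finite,linorder} set \<Rightarrow> 'n set \<Rightarrow> real" where
  "shuffle_sign I J = (-1) ^ card {(i, j). i \<in> I \<and> j \<in> J \<and> j < i}"

definition wedge :: "real^('n::{finite,linorder} set) \<Rightarrow> real^('n set) \<Rightarrow> real^('n set)" where
  "wedge a b = (\<chi> J. \<Sum>I\<in>Pow J. shuffle_sign I (J - I) * a $ I * b $ (J - I))"

text \<open>\<open>\<star>dx\<^sub>I = shuffle_sign I (-I) dx\<^sub>-\<^sub>I\<close>.\<close>

definition hodge_star :: "real^('n::{finite,linorder} set) \<Rightarrow> real^('n set)" where
  "hodge_star a = (\<chi> J. shuffle_sign (- J) J * a $ (- J))"

lemma wedge_hodge_star: "wedge a (hodge_star b) $ UNIV = a \<bullet> b"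
proof -
  have s: "shuffle_sign I J * shuffle_sign I J = 1" for I J :: "'a set"
    by (simp add: shuffle_sign_def flip: power_mult_distrib)
  have "shuffle_sign I (UNIV - I) * a $ I * (shuffle_sign I (UNIV - I) * b $ I) = a $ I * b $ I"
    for I :: "'a set"
    using s[of I "UNIV - I"] by (simp add: algebra_simps)
  then have "(\<Sum>I\<in>UNIV. shuffle_sign I (UNIV - I) * a $ I * (shuffle_sign I (UNIV - I) * b $ I))
      = (\<Sum>I\<in>UNIV. a $ I * b $ I)"
    by (intro sum.cong refl)
  then show ?thesis
    by (simp add: wedge_def hodge_star_def inner_vec_def Compl_eq_Diff_UNIV Diff_Diff_Int)
qed

definition form_inner :: "'n::{finite,linorder} domain \<Rightarrow> 'n form \<Rightarrow> 'n form \<Rightarrow> real" where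
  "form_inner K v w =
     (LINT x:K|lebesgue. wedge (rep_l2 v x) (hodge_star (rep_l2 w x)) $ UNIV)"

definition vanishes_off :: "'n::finite domain \<Rightarrow> 'n form \<Rightarrow> bool" where
  "vanishes_off K v \<longleftrightarrow> (AE x in lebesgue. x \<notin> K \<longrightarrow> rep_l2 v x = 0)"

definition L2\<Lambda> :: "int \<Rightarrow> 'n::finite domain \<Rightarrow> 'n form set" where
  "L2\<Lambda> j K = {v. vanishes_off K v \<and>
                  (\<forall>I. int (card I) \<noteq> j \<longrightarrow> (AE x in lebesgue. rep_l2 v x $ I = 0))}"

definition restr :: "'n::finite domain \<Rightarrow> 'n form \<Rightarrow> 'n form" where
  "restr K v = abs_l2 (\<lambda>x. indicator K x *\<^sub>R rep_l2 v x)"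


section \<open>Test functions and the distributional exterior derivative\<close>

definition partial_deriv :: "'n::finite \<Rightarrow> (real^'n \<Rightarrow> real) \<Rightarrow> real^'n \<Rightarrow> real" where
  "partial_deriv j \<phi> x = frechet_derivative \<phi> (at x) (axis j 1)"

primrec C_fun :: "nat \<Rightarrow> (real^'n::finite \<Rightarrow> real) \<Rightarrow> bool" where
  "C_fun 0 \<phi> \<longleftrightarrow> continuous_on UNIV \<phi>"
| "C_fun (Suc m) \<phi> \<longleftrightarrow> (\<forall>x. \<phi> differentiable (at x)) \<and> (\<forall>j. C_fun m (partial_deriv j \<phi>))"

definition test_fun :: "'n::finite domain \<Rightarrow> (real^'n \<Rightarrow> real) \<Rightarrow> bool" where
  "test_fun K \<phi> \<longleftrightarrow>
     (\<forall>m. C_fun m \<phi>) \<and> (\<exists>C. compact C \<and> C \<subseteq> K \<and> (\<forall>x. x \<notin> C \<longrightarrow> \<phi> x = 0))"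

definition test_forms :: "int \<Rightarrow> 'n::finite domain \<Rightarrow> 'n form set" where
  "test_forms j K = {abs_l2 (\<lambda>x. \<chi> I. \<phi> I x) |\<phi>.
     (\<forall>I. test_fun K (\<phi> I)) \<and> (\<forall>I. int (card I) \<noteq> j \<longrightarrow> \<phi> I = (\<lambda>x. 0))}"

text \<open>
  \<open>w = dv = \<Sum>\<^sub>j dx\<^sub>j \<and> \<partial>\<^sub>j v\<close> in the sense of distributions on \<open>K\<close>, written out
  coefficientwise: \<open>(dv)\<^sub>J = \<Sum>\<^sub>j\<^sub>\<in>\<^sub>J shuffle_sign {j} (J - {j}) \<partial>\<^sub>j v\<^sub>J\<^sub>-\<^sub>{\<^sub>j\<^sub>}\<close>.
\<close>

definition has_ext_d ::
  "'n::{finite,linorder} domain \<Rightarrow> 'n form \<Rightarrow> 'n form \<Rightarrow> bool" where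
  "has_ext_d K v w \<longleftrightarrow> vanishes_off K w \<and>
     (\<forall>J \<phi>. test_fun K \<phi> \<longrightarrow>
        (LINT x:K|lebesgue. rep_l2 w x $ J * \<phi> x) =
        - (\<Sum>j\<in>J. shuffle_sign {j} (J - {j}) *
             (LINT x:K|lebesgue. rep_l2 v x $ (J - {j}) * partial_deriv j \<phi> x)))"

definition ext_d :: "'n::{finite,linorder} domain \<Rightarrow> 'n form \<Rightarrow> 'n form" where
  "ext_d K v = (THE w. has_ext_d K v w)"

definition H\<Lambda> :: "int \<Rightarrow> 'n::{finite,linorder} domain \<Rightarrow> 'n form set" where
  "H\<Lambda> j K = {v \<in> L2\<Lambda> j K. \<exists>w \<in> L2\<Lambda> (j + 1) K. has_ext_d K v w}"

definition graph_norm :: "'n::{finite,linorder} domain \<Rightarrow> 'n form \<Rightarrow> real" where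
  "graph_norm K v = sqrt (form_inner K v v + form_inner K (ext_d K v) (ext_d K v))"

definition H0\<Lambda> :: "int \<Rightarrow> 'n::{finite,linorder} domain \<Rightarrow> 'n form set" where
  "H0\<Lambda> j K = {v \<in> H\<Lambda> j K. \<forall>\<epsilon>>0. \<exists>\<phi>\<in>test_forms j K. graph_norm K (v - \<phi>) < \<epsilon>}"


section \<open>Lipschitz domains and decompositions\<close>

text \<open>
  Near each boundary point, \<open>D\<close> is the strict epigraph, in some unit direction \<open>e\<close>, of a
  Lipschitz function of the component orthogonal to \<open>e\<close>.
\<close>

definition lipschitz_domain :: "'a::euclidean_space set \<Rightarrow> bool" where
  "lipschitz_domain D \<longleftrightarrow> open D \<and> connected D \<and> D \<noteq> {} \<and>
     (\<forall>p\<in>frontier D. \<exists>U e g L. open U \<and> p \<in> U \<and> norm e = 1 \<and>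
        L-lipschitz_on UNIV (g :: 'a \<Rightarrow> real) \<and>
        D \<inter> U = {x \<in> U. g (x - (x \<bullet> e) *\<^sub>R e) < x \<bullet> e})"

definition decomposition :: "'a::euclidean_space set \<Rightarrow> 'a set set \<Rightarrow> bool" where
  "decomposition \<Omega> T \<longleftrightarrow> finite T \<and> (\<forall>K\<in>T. lipschitz_domain K \<and> K \<subseteq> \<Omega>) \<and>
     disjoint T \<and> \<Omega> \<subseteq> (\<Union>K\<in>T. closure K)"


section \<open>Broken forms\<close>

text \<open>
  The interfaces of a decomposition are null sets, so a family of \<open>L\<^sup>2\<close> forms on the
  subdomains is the same as one \<open>L\<^sup>2\<close> form \<open>v\<close> on \<open>\<Omega>\<close>, the component on \<open>K\<close> being
  \<open>restr K v\<close>. Under this identification \<open>broken_space\<close> is the product of the spaces \<open>S K\<close>,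
  and \<open>H\<Lambda> j \<Omega>\<close> is literally a subspace of the broken space.
\<close>

definition broken_space ::
  "'n::finite domain \<Rightarrow> 'n domain set \<Rightarrow> int \<Rightarrow> ('n domain \<Rightarrow> 'n form set) \<Rightarrow> 'n form set"
  where "broken_space \<Omega> T j S = {v \<in> L2\<Lambda> j \<Omega>. \<forall>K\<in>T. restr K v \<in> S K}"

definition broken_inner ::
  "'n::{finite,linorder} domain set \<Rightarrow> 'n form \<Rightarrow> 'n form \<Rightarrow> real" where
  "broken_inner T v w = (\<Sum>K\<in>T. form_inner K (restr K v) (restr K w))"

definition broken_d :: "'n::{finite,linorder} domain set \<Rightarrow> 'n form \<Rightarrow> 'n form" where
  "broken_d T v = (\<Sum>K\<in>T. ext_d K (restr K v))"


section \<open>Tangential traces\<close>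

text \<open>
  A trace on \<open>\<partial>T = \<Squnion>\<^sub>K \<partial>K\<close> is a family, indexed by \<open>K \<in> T\<close>, of cosets of
  \<open>H0\<Lambda> j K\<close> in \<open>H\<Lambda> j K\<close>; \<open>trace_add\<close>, \<open>trace_diff\<close> and \<open>trace_scale\<close> are the
  operations of the product of these quotient spaces.
\<close>

type_synonym 'n trace = "'n domain \<Rightarrow> 'n form set"

definition tan_trace ::
  "'n::{finite,linorder} domain set \<Rightarrow> int \<Rightarrow> 'n form \<Rightarrow> 'n trace" where
  "tan_trace T j v = (\<lambda>K\<in>T. {restr K v + z |z. z \<in> H0\<Lambda> j K})"

definition trace_add :: "'n::finite domain set \<Rightarrow> 'n trace \<Rightarrow> 'n trace \<Rightarrow> 'n trace" where
  "trace_add T A B = (\<lambda>K\<in>T. {a + b |a b. a \<in> A K \<and> b \<in> B K})"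

definition trace_diff :: "'n::finite domain set \<Rightarrow> 'n trace \<Rightarrow> 'n trace \<Rightarrow> 'n trace" where
  "trace_diff T A B = (\<lambda>K\<in>T. {a - b |a b. a \<in> A K \<and> b \<in> B K})"

definition trace_scale ::
  "'n::{finite,linorder} domain set \<Rightarrow> int \<Rightarrow> real \<Rightarrow> 'n trace \<Rightarrow> 'n trace" where
  "trace_scale T j c A = (\<lambda>K\<in>T. {c *\<^sub>R a + z |a z. a \<in> A K \<and> z \<in> H0\<Lambda> j K})"

text \<open>
  The dual of a space \<open>X\<close> of traces. All spaces to which this is applied are
  finite-dimensional, so linear functionals are automatically continuous. Functionals are
  extensional on \<open>X\<close>, so that equal functionals are equal as functions; the duality pairing
  of \<open>A \<in> X\<close> with \<open>l\<close> is \<open>l A\<close>.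
\<close>

definition trace_dual ::
  "'n::{finite,linorder} domain set \<Rightarrow> int \<Rightarrow> 'n trace set \<Rightarrow> ('n trace \<Rightarrow> real) set" where
  "trace_dual T j X = {l \<in> extensional X.
     (\<forall>A\<in>X. \<forall>B\<in>X. l (trace_add T A B) = l A + l B) \<and>
     (\<forall>c. \<forall>A\<in>X. l (trace_scale T j c A) = c * l A)}"


section \<open>Discrete spaces\<close>

definition fd_subcomplex ::
  "'n::{finite,linorder} domain \<Rightarrow> (int \<Rightarrow> 'n form set) \<Rightarrow> bool" where
  "fd_subcomplex K X \<longleftrightarrow>
     (\<forall>j. subspace (X j) \<and> (\<exists>B. finite B \<and> X j = span B) \<and> X j \<subseteq> H\<Lambda> j K \<and>
          ext_d K ` X j \<subseteq> X (j + 1))"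

text \<open>In the following, \<open>W K j\<close> is the local space of \<open>j\<close>-forms on \<open>K\<close>.\<close>

type_synonym 'n local_spaces = "'n domain \<Rightarrow> int \<Rightarrow> 'n form set"

definition Wh ::
  "'n::{finite,linorder} domain \<Rightarrow> 'n domain set \<Rightarrow> 'n local_spaces \<Rightarrow> int \<Rightarrow> 'n form set"
  where "Wh \<Omega> T W j = broken_space \<Omega> T j (\<lambda>K. W K j)"

definition Vh ::
  "'n::{finite,linorder} domain \<Rightarrow> 'n domain set \<Rightarrow> 'n local_spaces \<Rightarrow> int \<Rightarrow> 'n form set"
  where "Vh \<Omega> T W j = H\<Lambda> j \<Omega> \<inter> Wh \<Omega> T W j"

definition W0 :: "'n::{finite,linorder} local_spaces \<Rightarrow> 'n domain \<Rightarrow> int \<Rightarrow> 'n form set" where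
  "W0 W K j = W K j \<inter> H0\<Lambda> j K"

definition local_harmonic ::
  "'n::{finite,linorder} local_spaces \<Rightarrow> int \<Rightarrow> 'n domain \<Rightarrow> 'n form set" where
  "local_harmonic W k K =
     {v \<in> W0 W K k. ext_d K v = 0 \<and> (\<forall>w\<in>W0 W K (k - 1). form_inner K v (ext_d K w) = 0)}"

definition broken_harmonic ::
  "'n::{finite,linorder} domain \<Rightarrow> 'n domain set \<Rightarrow> 'n local_spaces \<Rightarrow> int \<Rightarrow> 'n form set"
  where "broken_harmonic \<Omega> T W k = broken_space \<Omega> T k (local_harmonic W k)"

definition harmonic ::
  "'n::{finite,linorder} domain \<Rightarrow> 'n domain set \<Rightarrow> 'n local_spaces \<Rightarrow> int \<Rightarrow> 'n form set"
  where "harmonic \<Omega> T W k =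
     {v \<in> Vh \<Omega> T W k. ext_d \<Omega> v = 0 \<and>
        (\<forall>w\<in>Vh \<Omega> T W (k - 1). form_inner \<Omega> v (ext_d \<Omega> w) = 0)}"

definition W_tan ::
  "'n::{finite,linorder} domain \<Rightarrow> 'n domain set \<Rightarrow> 'n local_spaces \<Rightarrow> int \<Rightarrow> 'n trace set"
  where "W_tan \<Omega> T W j = tan_trace T j ` Wh \<Omega> T W j"

definition V_tan ::
  "'n::{finite,linorder} domain \<Rightarrow> 'n domain set \<Rightarrow> 'n local_spaces \<Rightarrow> int \<Rightarrow> 'n trace set"
  where "V_tan \<Omega> T W j = tan_trace T j ` Vh \<Omega> T W j"

definition W_nor ::
  "'n::{finite,linorder} domain \<Rightarrow> 'n domain set \<Rightarrow> 'n local_spaces \<Rightarrow> int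
     \<Rightarrow> ('n trace \<Rightarrow> real) set"
  where "W_nor \<Omega> T W j = trace_dual T j (W_tan \<Omega> T W j)"

definition is_orth_proj ::
  "'n::{finite,linorder} domain set \<Rightarrow> 'n form set \<Rightarrow> 'n form \<Rightarrow> 'n form \<Rightarrow> bool" where
  "is_orth_proj T X u w \<longleftrightarrow> w \<in> X \<and> (\<forall>q\<in>X. broken_inner T (u - w) q = 0)"


section \<open>The hybrid problem and the FEEC problem\<close>

text \<open>
  \<open>pb\<close>, \<open>ub\<close> are the broken harmonic unknowns; \<open>un\<close>, \<open>rn\<close> are the normal traces of \<open>u\<close>, \<open>\<rho>\<close>;
  \<open>st\<close>, \<open>ut\<close> are the tangential traces of \<open>\<sigma>\<close>, \<open>u\<close>.
\<close>

definition hybrid_a ::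
  "'n::{finite,linorder} domain \<Rightarrow> 'n domain set \<Rightarrow> 'n local_spaces \<Rightarrow> int
    \<Rightarrow> 'n form \<Rightarrow> 'n form \<Rightarrow> ('n trace \<Rightarrow> real) \<Rightarrow> bool" where
  "hybrid_a \<Omega> T W k \<sigma> u un \<longleftrightarrow>
     (\<forall>\<tau>\<in>Wh \<Omega> T W (k - 1).
        broken_inner T \<sigma> \<tau> - broken_inner T u (broken_d T \<tau>) + un (tan_trace T (k - 1) \<tau>) = 0)"

definition hybrid_b ::
  "'n::{finite,linorder} domain \<Rightarrow> 'n domain set \<Rightarrow> 'n local_spaces \<Rightarrow> int \<Rightarrow> 'n form
    \<Rightarrow> 'n form \<Rightarrow> 'n form \<Rightarrow> 'n form \<Rightarrow> 'n form \<Rightarrow> ('n trace \<Rightarrow> real) \<Rightarrow> bool" where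
  "hybrid_b \<Omega> T W k f \<sigma> u pb p rn \<longleftrightarrow>
     (\<forall>v\<in>Wh \<Omega> T W k.
        broken_inner T (broken_d T \<sigma>) v + broken_inner T (broken_d T u) (broken_d T v)
          + broken_inner T (pb + p) v - rn (tan_trace T k v)
        = broken_inner T f v)"

definition hybrid_solution ::
  "'n::{finite,linorder} domain \<Rightarrow> 'n domain set \<Rightarrow> 'n local_spaces \<Rightarrow> int \<Rightarrow> 'n form
    \<Rightarrow> 'n form \<Rightarrow> 'n form \<Rightarrow> 'n form \<Rightarrow> ('n trace \<Rightarrow> real) \<Rightarrow> ('n trace \<Rightarrow> real)
    \<Rightarrow> 'n form \<Rightarrow> 'n form \<Rightarrow> 'n trace \<Rightarrow> 'n trace \<Rightarrow> bool" where
  "hybrid_solution \<Omega> T W k f \<sigma> u pb un rn p ub st ut \<longleftrightarrow>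
     \<sigma> \<in> Wh \<Omega> T W (k - 1) \<and> u \<in> Wh \<Omega> T W k \<and> pb \<in> broken_harmonic \<Omega> T W k \<and>
     un \<in> W_nor \<Omega> T W (k - 1) \<and> rn \<in> W_nor \<Omega> T W k \<and>
     p \<in> harmonic \<Omega> T W k \<and> ub \<in> broken_harmonic \<Omega> T W k \<and>
     st \<in> V_tan \<Omega> T W (k - 1) \<and> ut \<in> V_tan \<Omega> T W k \<and>
     hybrid_a \<Omega> T W k \<sigma> u un \<and>
     hybrid_b \<Omega> T W k f \<sigma> u pb p rn \<and>
     (\<forall>q\<in>broken_harmonic \<Omega> T W k. broken_inner T (ub - u) q = 0) \<and>
     (\<forall>v\<in>W_nor \<Omega> T W (k - 1). v (trace_diff T st (tan_trace T (k - 1) \<sigma>)) = 0) \<and>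
     (\<forall>\<eta>\<in>W_nor \<Omega> T W k. \<eta> (trace_diff T ut (tan_trace T k u)) = 0) \<and>
     (\<forall>q\<in>harmonic \<Omega> T W k. broken_inner T u q = 0) \<and>
     (\<forall>v\<in>broken_harmonic \<Omega> T W k. broken_inner T pb v = 0) \<and>
     (\<forall>\<tau>\<in>V_tan \<Omega> T W (k - 1). un \<tau> = 0) \<and>
     (\<forall>v\<in>V_tan \<Omega> T W k. rn v = 0)"

definition FEEC_solution ::
  "'n::{finite,linorder} domain \<Rightarrow> 'n domain set \<Rightarrow> 'n local_spaces \<Rightarrow> int \<Rightarrow> 'n form
    \<Rightarrow> 'n form \<Rightarrow> 'n form \<Rightarrow> 'n form \<Rightarrow> bool" where
  "FEEC_solution \<Omega> T W k f \<sigma> u p \<longleftrightarrow>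
     \<sigma> \<in> Vh \<Omega> T W (k - 1) \<and> u \<in> Vh \<Omega> T W k \<and> p \<in> harmonic \<Omega> T W k \<and>
     (\<forall>\<tau>\<in>Vh \<Omega> T W (k - 1). form_inner \<Omega> \<sigma> \<tau> - form_inner \<Omega> u (ext_d \<Omega> \<tau>) = 0) \<and>
     (\<forall>v\<in>Vh \<Omega> T W k.
        form_inner \<Omega> (ext_d \<Omega> \<sigma>) v + form_inner \<Omega> (ext_d \<Omega> u) (ext_d \<Omega> v)
          + form_inner \<Omega> p v = form_inner \<Omega> f v) \<and>
     (\<forall>q\<in>harmonic \<Omega> T W k. form_inner \<Omega> u q = 0)"

text \<open>The pairs of normal traces that satisfy the first two hybrid equations.\<close>

definition normal_pairs ::
  "'n::{finite,linorder} domain \<Rightarrow> 'n domain set \<Rightarrow> 'n local_spaces \<Rightarrow> int \<Rightarrow> 'n form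
    \<Rightarrow> 'n form \<Rightarrow> 'n form \<Rightarrow> 'n form \<Rightarrow> 'n form
    \<Rightarrow> (('n trace \<Rightarrow> real) \<times> ('n trace \<Rightarrow> real)) set" where
  "normal_pairs \<Omega> T W k f \<sigma> u pb p =
     {(un, rn). un \<in> W_nor \<Omega> T W (k - 1) \<and> rn \<in> W_nor \<Omega> T W k \<and>
        hybrid_a \<Omega> T W k \<sigma> u un \<and> hybrid_b \<Omega> T W k f \<sigma> u pb p rn}"

end

theory Submission
  imports Defs
begin

text \<open>
  Equations (d) and (e) test against the full duals of the trace spaces, which separate
  traces; hence \<open>\<sigma>\<close> and \<open>u\<close> have the tangential traces of conforming forms. A broken form
  whose restrictions lie in \<open>H0\<Lambda> j K\<close> extends by zero to a form in \<open>H\<Lambda> j \<Omega>\<close>, because test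
  forms on \<open>K\<close> are test forms on \<open>\<Omega>\<close> and the weak identity passes to graph-norm limits; so
  \<open>\<sigma>\<close> and \<open>u\<close> are conforming. On conforming test forms (h) and (i) remove the normal traces
  from (a) and (b), and (g) with test form \<open>pb\<close> gives \<open>pb = 0\<close>, which leaves the FEEC problem.
  Conversely, the residuals of the FEEC problem are functionals on the broken spaces that
  vanish on forms with zero trace, as these are conforming; they therefore factor through the
  traces, and the factors are the only normal traces satisfying (a) and (b).

  For this the distributional derivative must be single-valued (tested with bumps converging to
  indicators of boxes), test forms must have their classical derivative as weak derivative,
  and the interfaces of the decomposition must be null sets (being locally Lipschitz graphs).
\<close>

section \<open>Square-integrable forms\<close>

text \<open>Forms on \<open>K\<close> and on \<open>\<Omega>\<close> live in one type, as classes on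
  the whole space, so extension by zero changes nothing in the data; what has to be shown is that a
  weak derivative on \<open>K\<close> is still one on \<open>\<Omega>\<close>. With traces taken as
  cosets of \<open>H0\<Lambda> j K\<close>, zero trace means membership in a graph-norm closure, and
  no Green formula or trace operator enters. The weak derivative is therefore recast as an identity
  between inner products with coefficient forms \<open>\<phi> dx_J\<close>: linearity, change of
  domain and passage to the limit then come from facts about \<open>form_inner\<close>. Since
  \<open>ext_d\<close> is a definite description, nothing can be computed with it before uniqueness
  is known; hence the fundamental lemma precedes all work on \<open>ext_d\<close>. Null interfaces
  make broken inner products and, on conforming forms, broken derivatives coincide with the global
  ones, so both problems can be compared term by term.\<close>

lemma square_integrable_rep: "square_integrable (rep_l2 v)"
  using Quotient3_rep_reflp[OF Quotient3_l2, of v] by (simp add: l2_rel_def)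

lemma l2_eqI: "(AE x in lebesgue. rep_l2 v x = rep_l2 w x) \<Longrightarrow> v = w"
  using Quotient3_rel_rep[OF Quotient3_l2, of v w]
  by (simp add: l2_rel_def square_integrable_rep)

lemma rep_abs_l2: "square_integrable f \<Longrightarrow> AE x in lebesgue. rep_l2 (abs_l2 f) x = f x"
  using rep_abs_rsp_left[OF Quotient3_l2, of f f] by (simp add: l2_rel_def)

lemma rep_l2_zero: "AE x in lebesgue. rep_l2 (0 :: ('a::euclidean_space, 'b::euclidean_space) l2) x = 0"
  unfolding zero_l2_def by (rule rep_abs_l2) (rule square_integrable_zero)

lemma rep_l2_add: "AE x in lebesgue. rep_l2 (v + w) x = rep_l2 v x + rep_l2 w x"
  unfolding plus_l2_def map_fun_def o_def
  by (simp add: rep_abs_l2 square_integrable_add square_integrable_rep)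

lemma rep_l2_scaleR: "AE x in lebesgue. rep_l2 (c *\<^sub>R v) x = c *\<^sub>R rep_l2 v x"
  unfolding scaleR_l2_def map_fun_def o_def
  by (simp add: rep_abs_l2 square_integrable_scaleR square_integrable_rep)

lemma rep_l2_sum:
  "finite A \<Longrightarrow> AE x in lebesgue. rep_l2 (\<Sum>i\<in>A. v i) x = (\<Sum>i\<in>A. rep_l2 (v i) x)"
proof (induction rule: finite_induct)
  case empty
  show ?case using rep_l2_zero by simp
next
  case (insert a A)
  show ?case
    using rep_l2_add[of "v a" "sum v A"] insert.IH by eventually_elim (use insert.hyps in simp)
qed

lemma borel_measurable_rep_l2 [measurable]: "rep_l2 v \<in> borel_measurable lebesgue"
  using square_integrable_rep by (auto simp: square_integrable_def)

lemma integrable_inner_square_integrable: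
  assumes "square_integrable f" "square_integrable g"
  shows "integrable lebesgue (\<lambda>x. f x \<bullet> g x)"
proof (rule Bochner_Integration.integrable_bound)
  show "integrable lebesgue (\<lambda>x. (norm (f x))\<^sup>2 + (norm (g x))\<^sup>2)"
    using assms by (simp add: square_integrable_def)
  show "(\<lambda>x. f x \<bullet> g x) \<in> borel_measurable lebesgue"
    using assms unfolding square_integrable_def by (intro borel_measurable_inner) auto
  have "\<bar>f x \<bullet> g x\<bar> \<le> (norm (f x))\<^sup>2 + (norm (g x))\<^sup>2" for x
    using Cauchy_Schwarz_ineq2[of "f x" "g x"] sum_squares_bound[of "norm (f x)" "norm (g x)"]
      mult_nonneg_nonneg[OF norm_ge_zero norm_ge_zero, of "f x" "g x"]
    by linarith
  then show "AE x in lebesgue. norm (f x \<bullet> g x) \<le> norm ((norm (f x))\<^sup>2 + (norm (g x))\<^sup>2)"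
    by simp
qed

lemma form_inner_eq:
  "form_inner K v w = (LINT x:K|lebesgue. rep_l2 v x \<bullet> rep_l2 w x)"
  by (simp add: form_inner_def wedge_hodge_star)

lemma set_integrable_inner:
  "K \<in> sets lebesgue \<Longrightarrow> set_integrable lebesgue K (\<lambda>x. rep_l2 v x \<bullet> rep_l2 w x)"
  unfolding set_integrable_def
  by (intro integrable_mult_indicator integrable_inner_square_integrable square_integrable_rep)

lemma form_inner_commute: "form_inner K v w = form_inner K w v"
  by (simp add: form_inner_eq inner_commute)

lemma form_inner_add_left:
  assumes "K \<in> sets lebesgue"
  shows "form_inner K (u + v) w = form_inner K u w + form_inner K v w"
proof -
  have "form_inner K (u + v) w
      = (LINT x:K|lebesgue. rep_l2 u x \<bullet> rep_l2 w x + rep_l2 v x \<bullet> rep_l2 w x)"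
    unfolding form_inner_eq
    by (rule set_lebesgue_integral_cong_AE)
       (auto simp: assms inner_add_left intro: eventually_mono[OF rep_l2_add[of u v]])
  then show ?thesis
    using assms by (simp add: set_integral_add set_integrable_inner form_inner_eq)
qed

lemma form_inner_scaleR_left:
  assumes "K \<in> sets lebesgue"
  shows "form_inner K (c *\<^sub>R v) w = c * form_inner K v w"
proof -
  have "form_inner K (c *\<^sub>R v) w = (LINT x:K|lebesgue. c * (rep_l2 v x \<bullet> rep_l2 w x))"
    unfolding form_inner_eq
    by (rule set_lebesgue_integral_cong_AE)
       (auto simp: assms intro: eventually_mono[OF rep_l2_scaleR[of c v]])
  then show ?thesis by (simp add: form_inner_eq)
qed

lemma form_inner_add_right:
  "K \<in> sets lebesgue \<Longrightarrow> form_inner K w (u + v) = form_inner K w u + form_inner K w v"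
  by (simp add: form_inner_commute[of K w] form_inner_add_left)

lemma form_inner_scaleR_right:
  "K \<in> sets lebesgue \<Longrightarrow> form_inner K w (c *\<^sub>R v) = c * form_inner K w v"
  by (simp add: form_inner_commute[of K w] form_inner_scaleR_left)

lemma form_inner_diff_left:
  "K \<in> sets lebesgue \<Longrightarrow> form_inner K (u - v) w = form_inner K u w - form_inner K v w"
  using form_inner_add_left[of K "u - v" v w] by simp

lemma form_inner_diff_right:
  "K \<in> sets lebesgue \<Longrightarrow> form_inner K w (u - v) = form_inner K w u - form_inner K w v"
  by (simp add: form_inner_commute[of K w] form_inner_diff_left)

lemma form_inner_zero_left [simp]: "K \<in> sets lebesgue \<Longrightarrow> form_inner K 0 w = 0"
  using form_inner_scaleR_left[of K 0 0 w] by simp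

lemma form_inner_zero_right [simp]: "K \<in> sets lebesgue \<Longrightarrow> form_inner K w 0 = 0"
  using form_inner_scaleR_right[of K w 0 0] by simp

lemma form_inner_sum_left:
  "K \<in> sets lebesgue \<Longrightarrow> form_inner K (sum v A) w = (\<Sum>i\<in>A. form_inner K (v i) w)"
  by (induction A rule: infinite_finite_induct) (simp_all add: form_inner_add_left)

lemma form_inner_sum_right:
  "K \<in> sets lebesgue \<Longrightarrow> form_inner K w (sum v A) = (\<Sum>i\<in>A. form_inner K w (v i))"
  by (simp add: form_inner_commute[of K w] form_inner_sum_left)

lemma form_inner_nonneg: "0 \<le> form_inner K v v"
  unfolding form_inner_eq set_lebesgue_integral_def by (rule Bochner_Integration.integral_nonneg) simp

text \<open>The pairing sees only the values on \<open>K\<close>; the rest of the class is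
  controlled by \<open>vanishes_off\<close>, and together they give definiteness.\<close>

lemma form_inner_self_eq_0:
  assumes K: "K \<in> sets lebesgue" and v: "vanishes_off K v" and eq: "form_inner K v v = 0"
  shows "v = 0"
proof (rule l2_eqI)
  have "AE x in lebesgue. indicator K x *\<^sub>R (rep_l2 v x \<bullet> rep_l2 v x) = 0"
    using eq set_integrable_inner[OF K, of v v]
    by (subst (asm) form_inner_eq, unfold set_lebesgue_integral_def set_integrable_def)
       (subst (asm) integral_nonneg_eq_0_iff_AE, auto)
  with v[unfolded vanishes_off_def] rep_l2_zero
  show "AE x in lebesgue. rep_l2 v x = rep_l2 0 x"
    by eventually_elim (auto simp: indicator_def split: if_splits)
qed

text \<open>Discriminant argument for the quadratic form of \<open>t v + s w\<close>; two parameters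
  allow a choice free of division in the nondegenerate case.\<close>

lemma form_inner_Cauchy_Schwarz:
  assumes K: "K \<in> sets lebesgue"
  shows "(form_inner K v w)\<^sup>2 \<le> form_inner K v v * form_inner K w w"
proof -
  let ?a = "form_inner K v v" and ?b = "form_inner K v w" and ?c = "form_inner K w w"
  have *: "0 \<le> ?a * t\<^sup>2 + 2 * ?b * t * s + ?c * s\<^sup>2" for t s
  proof -
    have "0 \<le> form_inner K (t *\<^sub>R v + s *\<^sub>R w) (t *\<^sub>R v + s *\<^sub>R w)"
      by (rule form_inner_nonneg)
    also have "\<dots> = ?a * t\<^sup>2 + 2 * ?b * t * s + ?c * s\<^sup>2"
      using K by (simp add: form_inner_add_left form_inner_add_right form_inner_scaleR_left
          form_inner_scaleR_right form_inner_commute[of K w v] power2_eq_square algebra_simps)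
    finally show ?thesis .
  qed
  show ?thesis
  proof (cases "?c = 0")
    case True
    have "?b = 0"
    proof (rule ccontr)
      assume "?b \<noteq> 0"
      then show False
        \<comment> \<open>With \<open>?c = 0\<close> this choice of \<open>s\<close> gives the
          quadratic form the value -1.\<close>
        using *[of 1 "- (?a + 1) / (2 * ?b)"] True by (simp add: field_simps)
    qed
    then show ?thesis using True by simp
  next
    case False
    then have "0 < ?c" using form_inner_nonneg[of K w] by simp
    have "0 \<le> ?c * (?a * ?c - ?b\<^sup>2)"
      using *[of ?c "- ?b"] by (simp add: power2_eq_square algebra_simps)
    with \<open>0 < ?c\<close> show ?thesis by (simp add: zero_le_mult_iff)
  qed
qed

text \<open>Norm convergence implies weak convergence; in this form the weak identity of a
  derivative passes to graph-norm limits.\<close>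

lemma form_inner_tendsto_0:
  assumes K: "K \<in> sets lebesgue" and u: "(\<lambda>n. form_inner K (u n) (u n)) \<longlonglongrightarrow> 0"
  shows "(\<lambda>n. form_inner K (u n) z) \<longlonglongrightarrow> 0"
proof (rule Lim_null_comparison)
  show "\<forall>\<^sub>F n in sequentially. norm (form_inner K (u n) z)
      \<le> sqrt (form_inner K (u n) (u n) * form_inner K z z)"
    using form_inner_Cauchy_Schwarz[OF K]
    by (intro always_eventually allI real_le_rsqrt) simp
  have "(\<lambda>n. sqrt (form_inner K (u n) (u n) * form_inner K z z)) \<longlonglongrightarrow> sqrt (0 * form_inner K z z)"
    by (intro tendsto_intros u)
  then show "(\<lambda>n. sqrt (form_inner K (u n) (u n) * form_inner K z z)) \<longlonglongrightarrow> 0" by simp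
qed

text \<open>The parallelogram law with the square of \<open>v - w\<close> dropped; it stands in for
  the triangle inequality of the graph norm.\<close>

lemma form_inner_add_self_le:
  assumes "K \<in> sets lebesgue"
  shows "form_inner K (v + w) (v + w) \<le> 2 * form_inner K v v + 2 * form_inner K w w"
  using form_inner_nonneg[of K "v - w"] assms
  by (simp add: form_inner_add_left form_inner_add_right form_inner_diff_left form_inner_diff_right)

text \<open>The integrand is already zero outside \<open>K\<close>, so pairings with forms supported
  in a subdomain may be moved between \<open>K\<close> and \<open>\<Omega>\<close>.\<close>

lemma form_inner_vanishes_off:
  assumes "K \<subseteq> \<Omega>" "K \<in> sets lebesgue" "\<Omega> \<in> sets lebesgue" "vanishes_off K w"
  shows "form_inner \<Omega> v w = form_inner K v w"
  unfolding form_inner_eq set_lebesgue_integral_def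
proof (rule integral_cong_AE)
  show "AE x in lebesgue. indicator \<Omega> x *\<^sub>R (rep_l2 v x \<bullet> rep_l2 w x)
      = indicator K x *\<^sub>R (rep_l2 v x \<bullet> rep_l2 w x)"
    using assms(4)[unfolded vanishes_off_def]
    by eventually_elim (use assms(1) in \<open>auto simp: indicator_def\<close>)
qed (use assms in auto)

section \<open>Forms supported in a domain, and restriction to a subdomain\<close>

lemma vanishes_off_zero [simp]: "vanishes_off (K :: 'a::finite domain) 0"
  unfolding vanishes_off_def by (rule eventually_mono[where P = "\<lambda>x. rep_l2 (0 :: 'a form) x = 0"]) (simp_all add: rep_l2_zero)

lemma vanishes_off_add:
  assumes "vanishes_off K v" "vanishes_off K w"
  shows "vanishes_off K (v + w)"
  using assms rep_l2_add[of v w] unfolding vanishes_off_def by eventually_elim simp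

lemma vanishes_off_scaleR:
  assumes "vanishes_off K v"
  shows "vanishes_off K (c *\<^sub>R v)"
  using assms rep_l2_scaleR[of c v] unfolding vanishes_off_def by eventually_elim simp

lemma vanishes_off_mono: "vanishes_off K v \<Longrightarrow> K \<subseteq> \<Omega> \<Longrightarrow> vanishes_off \<Omega> v"
  unfolding vanishes_off_def by (erule AE_mp) auto

lemma subspace_L2\<Lambda>: "subspace (L2\<Lambda> j (K :: 'a::finite domain))"
proof (rule subspaceI)
  show "0 \<in> L2\<Lambda> j K"
    unfolding L2\<Lambda>_def by (auto intro: eventually_mono[where P = "\<lambda>x. rep_l2 (0 :: 'a form) x = 0"] rep_l2_zero)
next
  fix v w assume vw: "v \<in> L2\<Lambda> j K" "w \<in> L2\<Lambda> j K"
  have "AE x in lebesgue. rep_l2 (v + w) x $ I = 0" if "int (card I) \<noteq> j" for I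
  proof -
    have "AE x in lebesgue. rep_l2 v x $ I = 0" "AE x in lebesgue. rep_l2 w x $ I = 0"
      using vw that by (simp_all add: L2\<Lambda>_def)
    with rep_l2_add[of v w] show ?thesis by eventually_elim simp
  qed
  with vw show "v + w \<in> L2\<Lambda> j K"
    by (simp add: L2\<Lambda>_def vanishes_off_add)
next
  fix c v assume v: "v \<in> L2\<Lambda> j K"
  have "AE x in lebesgue. rep_l2 (c *\<^sub>R v) x $ I = 0" if "int (card I) \<noteq> j" for I
  proof -
    have "AE x in lebesgue. rep_l2 v x $ I = 0" using v that by (simp add: L2\<Lambda>_def)
    with rep_l2_scaleR[of c v] show ?thesis by eventually_elim simp
  qed
  with v show "c *\<^sub>R v \<in> L2\<Lambda> j K"
    by (simp add: L2\<Lambda>_def vanishes_off_scaleR)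
qed

lemma L2\<Lambda>_mono: "K \<subseteq> \<Omega> \<Longrightarrow> L2\<Lambda> j K \<subseteq> L2\<Lambda> j \<Omega>"
  by (auto simp: L2\<Lambda>_def intro: vanishes_off_mono)

lemma rep_restr:
  assumes "K \<in> sets lebesgue"
  shows "AE x in lebesgue. rep_l2 (restr K v) x = indicator K x *\<^sub>R rep_l2 v x"
  unfolding restr_def
proof (rule rep_abs_l2)
  have "integrable lebesgue (\<lambda>x. indicator K x *\<^sub>R (norm (rep_l2 v x))\<^sup>2)"
    using square_integrable_rep[of v] assms
    by (intro integrable_mult_indicator) (auto simp: square_integrable_def)
  then have "integrable lebesgue (\<lambda>x. (norm (indicator K x *\<^sub>R rep_l2 v x))\<^sup>2)"
    by (rule Bochner_Integration.integrable_cong[THEN iffD1, rotated -1])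
       (auto simp: indicator_def)
  then show "square_integrable (\<lambda>x. indicator K x *\<^sub>R rep_l2 v x)"
    using assms by (auto simp: square_integrable_def)
qed

lemma restr_add:
  assumes "K \<in> sets lebesgue"
  shows "restr K (v + w) = restr K v + restr K w"
proof (rule l2_eqI)
  show "AE x in lebesgue. rep_l2 (restr K (v + w)) x = rep_l2 (restr K v + restr K w) x"
    using rep_restr[OF assms, of v] rep_restr[OF assms, of w] rep_restr[OF assms, of "v + w"]
      rep_l2_add[of v w] rep_l2_add[of "restr K v" "restr K w"]
    by eventually_elim (simp add: scaleR_add_right)
qed

lemma restr_scaleR:
  assumes "K \<in> sets lebesgue"
  shows "restr K (c *\<^sub>R v) = c *\<^sub>R restr K v"
proof (rule l2_eqI)
  show "AE x in lebesgue. rep_l2 (restr K (c *\<^sub>R v)) x = rep_l2 (c *\<^sub>R restr K v) x"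
    using rep_restr[OF assms, of v] rep_restr[OF assms, of "c *\<^sub>R v"]
      rep_l2_scaleR[of c v] rep_l2_scaleR[of c "restr K v"]
    by eventually_elim simp
qed

lemma restr_zero: "K \<in> sets lebesgue \<Longrightarrow> restr K 0 = 0"
  using restr_scaleR[of K 0 0] by simp

lemma restr_diff: "K \<in> sets lebesgue \<Longrightarrow> restr K (v - w) = restr K v - restr K w"
  using restr_add[of K "v - w" w] by simp

lemma vanishes_off_restr: "K \<in> sets lebesgue \<Longrightarrow> vanishes_off K (restr K v)"
  unfolding vanishes_off_def by (rule AE_mp[OF rep_restr]) auto

lemma form_inner_restr_left:
  assumes "K \<in> sets lebesgue"
  shows "form_inner K (restr K v) w = form_inner K v w"
  unfolding form_inner_eq set_lebesgue_integral_def
proof (rule integral_cong_AE)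
  show "AE x in lebesgue. indicator K x *\<^sub>R (rep_l2 (restr K v) x \<bullet> rep_l2 w x)
      = indicator K x *\<^sub>R (rep_l2 v x \<bullet> rep_l2 w x)"
    using rep_restr[OF assms, of v] by eventually_elim (auto simp: indicator_def)
qed (use assms in auto)

lemma form_inner_restr_right:
  "K \<in> sets lebesgue \<Longrightarrow> form_inner K w (restr K v) = form_inner K w v"
  by (simp add: form_inner_commute[of K w] form_inner_restr_left)

section \<open>Smooth compactly supported functions\<close>

lemma partial_deriv_eq:
  "(\<phi> has_derivative D) (at x) \<Longrightarrow> partial_deriv j \<phi> x = D (axis j 1)"
  by (simp add: partial_deriv_def frechet_derivative_at[symmetric])

text \<open>Bridge from the Frechet definition of \<open>partial_deriv\<close> to difference
  quotients along a coordinate line.\<close>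

lemma differentiable_has_partial_deriv:
  assumes "\<phi> differentiable (at x)"
  shows "((\<lambda>t. \<phi> (x + t *\<^sub>R axis j 1)) has_real_derivative partial_deriv j \<phi> x) (at 0)"
proof -
  have d: "(\<phi> has_derivative frechet_derivative \<phi> (at x)) (at x)"
    using assms frechet_derivative_works by blast
  then have lin: "linear (frechet_derivative \<phi> (at x))"
    by (rule has_derivative_linear)
  have "((\<phi> \<circ> (\<lambda>t. x + t *\<^sub>R axis j 1)) has_derivative
      (frechet_derivative \<phi> (at x) \<circ> (\<lambda>t. t *\<^sub>R axis j 1))) (at 0)"
    by (rule diff_chain_at) (use d in \<open>auto intro!: derivative_eq_intros\<close>)
  then show ?thesis
    using lin by (simp add: has_field_derivative_def o_def linear_cmul partial_deriv_def mult_commute_abs)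
qed

section \<open>Closure properties of \<open>C_fun\<close>\<close>

lemma C_fun_continuous: "C_fun m \<phi> \<Longrightarrow> continuous_on UNIV \<phi>"
  by (cases m) (auto intro: continuous_at_imp_continuous_on differentiable_imp_continuous_within)

lemma C_fun_Suc_D: "C_fun (Suc m) \<phi> \<Longrightarrow> C_fun m \<phi>"
proof (induction m arbitrary: \<phi>)
  case 0
  then show ?case using C_fun_continuous by (metis C_fun.simps(1))
next
  case (Suc m)
  then show ?case by (metis C_fun.simps(2))
qed

lemma C_fun_const: "C_fun m (\<lambda>x. c)"
proof (induction m arbitrary: c)
  case (Suc m)
  have "partial_deriv j (\<lambda>x. c) = (\<lambda>x. 0)" for j :: 'a
    by (rule ext) (simp add: partial_deriv_eq[OF has_derivative_const])
  then show ?case using Suc by simp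
qed simp

lemma C_fun_add: "C_fun m \<phi> \<Longrightarrow> C_fun m \<psi> \<Longrightarrow> C_fun m (\<lambda>x. \<phi> x + \<psi> x)"
proof (induction m arbitrary: \<phi> \<psi>)
  case 0
  then show ?case by (auto intro: continuous_on_add)
next
  case (Suc m)
  have "partial_deriv j (\<lambda>x. \<phi> x + \<psi> x) = (\<lambda>x. partial_deriv j \<phi> x + partial_deriv j \<psi> x)" for j
  proof
    fix x
    show "partial_deriv j (\<lambda>x. \<phi> x + \<psi> x) x = partial_deriv j \<phi> x + partial_deriv j \<psi> x"
      using Suc.prems partial_deriv_eq[OF has_derivative_add, of \<phi> _ x \<psi>]
      by (simp add: frechet_derivative_works partial_deriv_def)
  qed
  with Suc show ?case by auto
qed

lemma partial_deriv_mult: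
  assumes "\<phi> differentiable (at x)" "\<psi> differentiable (at x)"
  shows "partial_deriv j (\<lambda>x. \<phi> x * \<psi> x) x = \<phi> x * partial_deriv j \<psi> x + partial_deriv j \<phi> x * \<psi> x"
  using assms partial_deriv_eq[OF has_derivative_mult, of \<phi> _ x \<psi>]
  by (simp add: frechet_derivative_works partial_deriv_def)

lemma C_fun_mult: "C_fun m \<phi> \<Longrightarrow> C_fun m \<psi> \<Longrightarrow> C_fun m (\<lambda>x. \<phi> x * \<psi> x)"
proof (induction m arbitrary: \<phi> \<psi>)
  case 0
  then show ?case by (auto intro: continuous_on_mult)
next
  case (Suc m)
  have "partial_deriv j (\<lambda>x. \<phi> x * \<psi> x)
      = (\<lambda>x. \<phi> x * partial_deriv j \<psi> x + partial_deriv j \<phi> x * \<psi> x)" for j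
    using Suc.prems by (intro ext partial_deriv_mult) auto
  \<comment> \<open>The undifferentiated factors are \<open>C_fun (Suc m)\<close>; they fit the
    induction hypothesis after giving up one order.\<close>
  moreover have "C_fun m (\<lambda>x. \<phi> x * partial_deriv j \<psi> x + partial_deriv j \<phi> x * \<psi> x)" for j
    using Suc.prems C_fun_Suc_D[of m \<phi>] C_fun_Suc_D[of m \<psi>] by (intro C_fun_add Suc.IH) auto
  ultimately show ?case using Suc.prems by auto
qed

lemma C_fun_prod:
  "finite A \<Longrightarrow> (\<And>i. i \<in> A \<Longrightarrow> C_fun m (\<phi> i)) \<Longrightarrow> C_fun m (\<lambda>x. \<Prod>i\<in>A. \<phi> i x)"
  by (induction A rule: finite_induct) (auto intro: C_fun_const C_fun_mult)

text \<open>The family p(1/t) exp(-c/t), extended by zero to t <= 0. Polynomial prefactors make it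
  closed under differentiation, so smoothness becomes an induction; the rate \<open>c\<close> stays
  free because letting it tend to 0 turns the function with \<open>p = 1\<close> into the indicator
  of the positive axis.\<close>

definition flat_exp :: "real poly \<Rightarrow> real \<Rightarrow> real \<Rightarrow> real" where
  "flat_exp p c t = (if 0 < t then poly p (1 / t) * exp (- c / t) else 0)"

lemma tendsto_poly_exp_at_top:
  fixes c :: real
  assumes "0 < c"
  shows "((\<lambda>s. poly p s * exp (- c * s)) \<longlongrightarrow> 0) at_top"
proof -
  have 1: "((\<lambda>s. s ^ n * exp (- c * s)) \<longlongrightarrow> 0) at_top" for n
  proof -
    have "filterlim (\<lambda>s. c * s) at_top at_top"
      using assms by (auto intro!: filterlim_tendsto_pos_mult_at_top[where f = "\<lambda>_. c"] filterlim_ident)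
    from filterlim_compose[OF tendsto_power_div_exp_0[of n] this]
    have "((\<lambda>s. (1 / c ^ n) * ((c * s) ^ n / exp (c * s))) \<longlongrightarrow> (1 / c ^ n) * 0) at_top"
      by (intro tendsto_mult tendsto_const)
    then show ?thesis
      using assms by (simp add: power_mult_distrib exp_minus field_simps)
  qed
  have "((\<lambda>s. \<Sum>i\<le>degree p. coeff p i * (s ^ i * exp (- c * s))) \<longlongrightarrow>
      (\<Sum>i\<le>degree p. coeff p i * 0)) at_top"
    by (intro tendsto_sum tendsto_mult tendsto_const 1)
  then show ?thesis by (simp add: poly_altdef sum_distrib_right mult.assoc)
qed

text \<open>In the variable s = 1/t differentiation is -s^2 d/ds, which sends p(s) exp(-c s) to s^2
  (c p - p')(s) exp(-c s); \<open>[:0, 0, 1:]\<close> is s^2.\<close>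

lemma has_derivative_flat_exp:
  assumes "0 < c"
  shows "(flat_exp p c has_real_derivative
    flat_exp ([:0, 0, 1:] * (smult c p - pderiv p)) c t) (at t)"
proof -
  consider "0 < t" | "t < 0" | "t = 0" by linarith
  then show ?thesis
  proof cases
    case 1
    have "((\<lambda>t. poly p (1 / t) * exp (- c / t)) has_real_derivative
      poly p (1 / t) * (exp (- c / t) * (c / t\<^sup>2)) + poly (pderiv p) (1 / t) * (- (1 / t\<^sup>2)) * exp (- c / t)) (at t)"
      using 1 by (auto intro!: derivative_eq_intros poly_DERIV[THEN DERIV_chain2]
          simp: power2_eq_square)
    then have "((\<lambda>t. poly p (1 / t) * exp (- c / t)) has_real_derivative
      flat_exp ([:0, 0, 1:] * (smult c p - pderiv p)) c t) (at t)"
      using 1 by (simp add: flat_exp_def power2_eq_square field_simps)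
    then show ?thesis
      by (rule DERIV_cong_ev[THEN iffD1, rotated -1, OF _ refl _ refl])
         (use 1 in \<open>auto simp: flat_exp_def intro!: eventually_mono[OF eventually_nhds_in_open[of "{0<..}"]]\<close>)
  next
    case 2
    have "((\<lambda>t. 0) has_real_derivative flat_exp ([:0, 0, 1:] * (smult c p - pderiv p)) c t) (at t)"
      using 2 by (simp add: flat_exp_def)
    then show ?thesis
      by (rule DERIV_cong_ev[THEN iffD1, rotated -1, OF _ refl _ refl])
         (use 2 in \<open>auto simp: flat_exp_def intro!: eventually_mono[OF eventually_nhds_in_open[of "{..<0}"]]\<close>)
  next
    case 3
    \<comment> \<open>The right difference quotient at 0 is s p(s) exp(-c s) with s = 1/h, whence
      the extra factor \<open>[:0, 1:]\<close>; the left one is zero.\<close>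
    have "((\<lambda>s. poly ([:0, 1:] * p) s * exp (- c * s)) \<longlongrightarrow> 0) at_top"
      by (rule tendsto_poly_exp_at_top[OF assms])
    then have "((\<lambda>h. poly ([:0, 1:] * p) (inverse h) * exp (- c * inverse h)) \<longlongrightarrow> 0) (at_right 0)"
      by (rule filterlim_compose) (rule filterlim_inverse_at_top_right)
    then have r: "((\<lambda>h. flat_exp p c h / h) \<longlongrightarrow> 0) (at_right 0)"
      by (rule tendsto_cong[THEN iffD1, rotated])
         (auto simp: flat_exp_def field_simps eventually_at_filter)
    have l: "((\<lambda>h. flat_exp p c h / h) \<longlongrightarrow> 0) (at_left 0)"
      by (rule tendsto_eventually) (auto simp: flat_exp_def eventually_at_filter)
    have "((\<lambda>h. flat_exp p c h / h) \<longlongrightarrow> 0) (at 0)"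
      using l r by (simp add: filterlim_split_at)
    then show ?thesis
      using 3 by (simp add: DERIV_def flat_exp_def)
  qed
qed

text \<open>The polynomial is generalized in the induction, since each derivative changes it. The
  affine argument serves both faces of a box in direction \<open>i\<close>.\<close>

lemma C_fun_flat_exp:
  fixes i :: "'n::finite"
  assumes "0 < c"
  shows "C_fun m (\<lambda>x. flat_exp p c (s * x $ i + a))"
proof (induction m arbitrary: p)
  case 0
  have "isCont (flat_exp p c) t" for t
    using has_derivative_flat_exp[OF assms] by (rule DERIV_isCont)
  then have "continuous_on UNIV (flat_exp p c)"
    by (simp add: continuous_at_imp_continuous_on)
  then show ?case
    by (auto intro!: continuous_intros continuous_on_compose2[of UNIV "flat_exp p c"])
next
  case (Suc m)
  let ?q = "[:0, 0, 1:] * (smult c p - pderiv p)"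
  have d: "((\<lambda>x. flat_exp p c (s * x $ i + a)) has_derivative
      (\<lambda>h. flat_exp ?q c (s * x $ i + a) * (s * h $ i))) (at x)" for x :: "real^'n"
  proof -
    have "((\<lambda>x. s * x $ i + a) has_derivative (\<lambda>h. s * h $ i)) (at x)"
      by (auto intro!: derivative_eq_intros bounded_linear_imp_has_derivative)
    from DERIV_compose_FDERIV[OF has_derivative_flat_exp[OF assms] this]
    show ?thesis by (simp add: mult.commute)
  qed
  have "partial_deriv j (\<lambda>x. flat_exp p c (s * x $ i + a))
      = (\<lambda>x. (if j = i then s else 0) * flat_exp ?q c (s * x $ i + a))" for j
    by (rule ext, subst partial_deriv_eq[OF d]) (simp add: axis_def)
  moreover have "C_fun m (\<lambda>x. (if j = i then s else 0) * flat_exp ?q c (s * x $ i + a))" for j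
    by (intro C_fun_mult C_fun_const Suc.IH)
  ultimately show ?case using d by (auto simp: differentiable_def)
qed

text \<open>For \<open>c > 0\<close>, a smooth function that is nonzero exactly on
  \<open>box a b\<close>. The spelling with \<open>1 *\<close> and \<open>+ -\<close> matches the
  affine pattern of \<open>C_fun_flat_exp\<close>.\<close>

definition box_bump :: "real^'n::finite \<Rightarrow> real^'n \<Rightarrow> real \<Rightarrow> real^'n \<Rightarrow> real" where
  "box_bump a b c x = (\<Prod>i\<in>UNIV. flat_exp 1 c (1 * x $ i + - a $ i) * flat_exp 1 c ((-1) * x $ i + b $ i))"

lemma flat_exp_1: "0 < c \<Longrightarrow> 0 \<le> flat_exp 1 c t \<and> flat_exp 1 c t \<le> 1"
  by (simp add: flat_exp_def)

lemma box_bump_bounds: "0 < c \<Longrightarrow> 0 \<le> box_bump a b c x \<and> box_bump a b c x \<le> 1"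
  unfolding box_bump_def by (auto intro!: prod_nonneg prod_le_1 mult_le_one simp: flat_exp_1)

lemma box_bump_eq_0: "x \<notin> box a b \<Longrightarrow> box_bump a b c x = 0"
  by (force simp: box_bump_def mem_box_cart flat_exp_def)

lemma test_fun_box_bump:
  assumes "0 < c" "cbox a b \<subseteq> K"
  shows "test_fun K (box_bump a b c)"
  unfolding test_fun_def
proof (intro conjI exI[of _ "cbox a b"] allI impI)
  show "C_fun m (box_bump a b c)" for m
    unfolding box_bump_def using assms by (intro C_fun_prod C_fun_mult C_fun_flat_exp) auto
  show "box_bump a b c x = 0" if "x \<notin> cbox a b" for x
    using that box_subset_cbox by (intro box_bump_eq_0) blast
qed (use assms in auto)

text \<open>exp(-c/t) tends to 1 as c tends to 0 for every t > 0, and off the open box every bump is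
  exactly zero, so the limit holds at every point, boundary included.\<close>

lemma box_bump_tendsto:
  "(\<lambda>n. box_bump a b (1 / real (Suc n)) x) \<longlonglongrightarrow> indicator (box a b) x"
proof (cases "x \<in> box a b")
  case True
  have "(\<lambda>n. flat_exp 1 (1 / real (Suc n)) t) \<longlonglongrightarrow> 1" if "0 < t" for t
  proof -
    have "(\<lambda>n. exp (- (1 / real (Suc n)) / t)) \<longlonglongrightarrow> exp (- 0 / t)"
      by (intro tendsto_intros LIMSEQ_Suc[OF lim_1_over_n]) (use that in auto)
    then show ?thesis using that by (simp add: flat_exp_def)
  qed
  then have "(\<lambda>n. box_bump a b (1 / real (Suc n)) x) \<longlonglongrightarrow> (\<Prod>i\<in>(UNIV :: 'a set). 1 * 1)"
    unfolding box_bump_def using True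
    by (intro tendsto_prod tendsto_mult) (auto simp: mem_box_cart)
  then show ?thesis using True by simp
qed (simp add: box_bump_eq_0)

section \<open>Test functions\<close>

lemma test_fun_C_fun: "test_fun K \<phi> \<Longrightarrow> C_fun m \<phi>"
  by (simp add: test_fun_def)

lemma test_fun_differentiable: "test_fun K \<phi> \<Longrightarrow> \<phi> differentiable (at x)"
  using test_fun_C_fun[of K \<phi> 1] by simp

lemma test_fun_continuous: "test_fun K \<phi> \<Longrightarrow> continuous_on UNIV \<phi>"
  using test_fun_C_fun C_fun_continuous by blast

lemma test_fun_eq_0: "test_fun K \<phi> \<Longrightarrow> x \<notin> K \<Longrightarrow> \<phi> x = 0"
  by (auto simp: test_fun_def)

lemma test_fun_mono: "test_fun K \<phi> \<Longrightarrow> K \<subseteq> \<Omega> \<Longrightarrow> test_fun \<Omega> \<phi>"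
  by (auto simp: test_fun_def)

lemma test_fun_zero: "test_fun K (\<lambda>x. 0)"
  by (auto simp: test_fun_def C_fun_const intro: exI[of _ "{}"])

lemma test_fun_add:
  assumes "test_fun K \<phi>" "test_fun K \<psi>"
  shows "test_fun K (\<lambda>x. \<phi> x + \<psi> x)"
proof -
  obtain C D where C: "compact C" "C \<subseteq> K" "\<And>x. x \<notin> C \<Longrightarrow> \<phi> x = 0"
    and D: "compact D" "D \<subseteq> K" "\<And>x. x \<notin> D \<Longrightarrow> \<psi> x = 0"
    using assms by (auto simp: test_fun_def)
  then have "compact (C \<union> D) \<and> C \<union> D \<subseteq> K \<and> (\<forall>x. x \<notin> C \<union> D \<longrightarrow> \<phi> x + \<psi> x = 0)"
    by (simp add: compact_Un)
  with assms show ?thesis unfolding test_fun_def by (blast intro: C_fun_add)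
qed

lemma test_fun_mult:
  assumes "test_fun K \<phi>" "\<And>m. C_fun m \<psi>"
  shows "test_fun K (\<lambda>x. \<phi> x * \<psi> x)"
proof -
  obtain C where "compact C" "C \<subseteq> K" "\<And>x. x \<notin> C \<Longrightarrow> \<phi> x = 0"
    using assms by (auto simp: test_fun_def)
  then have "compact C \<and> C \<subseteq> K \<and> (\<forall>x. x \<notin> C \<longrightarrow> \<phi> x * \<psi> x = 0)" by simp
  with assms show ?thesis unfolding test_fun_def by (blast intro: C_fun_mult)
qed

lemma test_fun_scale: "test_fun K \<phi> \<Longrightarrow> test_fun K (\<lambda>x. c * \<phi> x)"
  using test_fun_mult[of K \<phi> "\<lambda>x. c", OF _ C_fun_const] by (simp add: mult.commute)

lemma test_fun_sum:
  "finite A \<Longrightarrow> (\<And>i. i \<in> A \<Longrightarrow> test_fun K (\<phi> i)) \<Longrightarrow> test_fun K (\<lambda>x. \<Sum>i\<in>A. \<phi> i x)"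
  by (induction A rule: finite_induct) (auto intro: test_fun_zero test_fun_add)

lemma test_fun_partial_deriv:
  assumes "test_fun K \<phi>"
  shows "test_fun K (partial_deriv j \<phi>)"
proof -
  obtain C where C: "compact C" "C \<subseteq> K" "\<And>x. x \<notin> C \<Longrightarrow> \<phi> x = 0"
    using assms by (auto simp: test_fun_def)
  have "partial_deriv j \<phi> x = 0" if "x \<notin> C" for x
  proof -
    have "open (- C)" using C(1) by (simp add: compact_imp_closed open_Compl)
    then have "(\<phi> has_derivative (\<lambda>h. 0)) (at x)"
      using that C(3) by (auto intro: has_derivative_transform_within_open[OF has_derivative_const])
    then show ?thesis by (simp add: partial_deriv_eq)
  qed
  moreover have "C_fun m (partial_deriv j \<phi>)" for m
    using test_fun_C_fun[OF assms, of "Suc m"] by simp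
  ultimately show ?thesis using C unfolding test_fun_def by blast
qed

lemma test_fun_bounded:
  assumes "test_fun K \<phi>"
  obtains B where "0 \<le> B" "\<And>x. \<bar>\<phi> x\<bar> \<le> B"
proof -
  obtain C where C: "compact C" "C \<subseteq> K" "\<And>x. x \<notin> C \<Longrightarrow> \<phi> x = 0"
    using assms by (auto simp: test_fun_def)
  have "compact (\<phi> ` C)"
    using C test_fun_continuous[OF assms] by (intro compact_continuous_image) (auto intro: continuous_on_subset)
  then obtain B where B: "\<And>x. x \<in> C \<Longrightarrow> \<bar>\<phi> x\<bar> \<le> B"
    by (meson bounded_real compact_imp_bounded imageI)
  show ?thesis
  proof (rule that[of "max B 0"])
    show "\<bar>\<phi> x\<bar> \<le> max B 0" for x
      using B[of x] C(3)[of x] by (cases "x \<in> C") auto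
  qed simp
qed

lemma test_fun_integrable:
  assumes "test_fun K \<phi>"
  shows "integrable lborel \<phi>"
proof -
  obtain C where C: "compact C" "C \<subseteq> K" "\<And>x. x \<notin> C \<Longrightarrow> \<phi> x = 0"
    using assms by (auto simp: test_fun_def)
  have "integrable lborel (\<lambda>x. indicator C x *\<^sub>R \<phi> x)"
    using C test_fun_continuous[OF assms]
    by (intro borel_integrable_compact[unfolded set_integrable_def]) (auto intro: continuous_on_subset)
  moreover have "(\<lambda>x. indicator C x *\<^sub>R \<phi> x) = \<phi>"
    using C(3) by (auto simp: fun_eq_iff indicator_def)
  ultimately show ?thesis by simp
qed

text \<open>Translation invariance makes the integral of every difference quotient zero, and
  dominated convergence carries this over to the derivative, in place of iterated integrals.\<close>

lemma integral_partial_deriv: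
  fixes \<phi> :: "real^'n::finite \<Rightarrow> real"
  assumes \<phi>: "test_fun K \<phi>"
  shows "(LINT x|lborel. partial_deriv j \<phi> x) = 0"
proof -
  have [measurable]: "\<phi> \<in> borel_measurable borel" "partial_deriv j \<phi> \<in> borel_measurable borel"
    using test_fun_continuous[OF \<phi>] test_fun_continuous[OF test_fun_partial_deriv[OF \<phi>]]
    by (auto intro: borel_measurable_continuous_onI)
  obtain C where C: "compact C" "C \<subseteq> K" "\<And>x. x \<notin> C \<Longrightarrow> \<phi> x = 0"
    using \<phi> by (auto simp: test_fun_def)
  obtain R where R: "\<And>x. x \<in> C \<Longrightarrow> norm x \<le> R"
    using C(1) compact_imp_bounded bounded_iff by metis
  obtain B where B: "0 \<le> B" "\<And>x. \<bar>partial_deriv j \<phi> x\<bar> \<le> B"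
    using test_fun_bounded[OF test_fun_partial_deriv[OF \<phi>]] by blast
  define e :: "real^'n" where "e = axis j 1"
  have e: "norm e = 1" by (simp add: e_def)
  define q where "q n x = real (Suc n) * (\<phi> (x + (1 / real (Suc n)) *\<^sub>R e) - \<phi> x)" for n x
  \<comment> \<open>The mean value inequality bounds all difference quotients by \<open>B\<close>,
    uniformly in \<open>n\<close>; this is the dominating constant.\<close>
  have lip: "\<bar>\<phi> (x + h *\<^sub>R e) - \<phi> x\<bar> \<le> B * h" if "0 \<le> h" for x h
  proof -
    have "norm (\<phi> (x + h *\<^sub>R e) - \<phi> (x + 0 *\<^sub>R e)) \<le> B * norm (h - 0)"
    proof (rule field_differentiable_bound[where S = UNIV])
      fix t :: real
      show "((\<lambda>s. \<phi> (x + s *\<^sub>R e)) has_real_derivative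
          partial_deriv j \<phi> (x + t *\<^sub>R e)) (at t within UNIV)"
        using differentiable_has_partial_deriv[OF test_fun_differentiable[OF \<phi>], of "x + t *\<^sub>R e" j]
          DERIV_shift[of "\<lambda>s. \<phi> (x + s *\<^sub>R e)" _ 0 t]
        by (simp add: e_def algebra_simps)
    qed (use B in auto)
    then show ?thesis using that by simp
  qed
  have "(\<lambda>n. LINT x|lborel. q n x) \<longlonglongrightarrow> (LINT x|lborel. partial_deriv j \<phi> x)"
  proof (rule integral_dominated_convergence)
    \<comment> \<open>\<open>\<phi>\<close> vanishes outside the ball of radius \<open>R\<close> and
      the shifts have length at most 1, so every \<open>q n\<close> vanishes outside radius
      \<open>R + 1\<close>.\<close>
    show "integrable lborel (\<lambda>x. B * indicator (cball (0 :: real^'n) (R + 1)) x)"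
      by (intro integrable_mult_right integrable_real_indicator emeasure_bounded_finite) auto
    show "AE x in lborel. (\<lambda>n. q n x) \<longlonglongrightarrow> partial_deriv j \<phi> x"
    proof (rule AE_I2)
      fix x
      have "((\<lambda>h. (\<phi> (x + h *\<^sub>R e) - \<phi> x) / h) \<longlongrightarrow> partial_deriv j \<phi> x) (at 0)"
        using differentiable_has_partial_deriv[OF test_fun_differentiable[OF \<phi>], of x j]
        by (simp add: DERIV_def e_def)
      moreover have "filterlim (\<lambda>n. 1 / real (Suc n)) (at 0) sequentially"
        using LIMSEQ_Suc[OF lim_1_over_n] by (auto simp: filterlim_at)
      ultimately have "((\<lambda>n. (\<phi> (x + (1 / real (Suc n)) *\<^sub>R e) - \<phi> x) / (1 / real (Suc n)))
          \<longlonglongrightarrow> partial_deriv j \<phi> x)"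
        by (rule filterlim_compose)
      then show "(\<lambda>n. q n x) \<longlonglongrightarrow> partial_deriv j \<phi> x"
        by (simp add: q_def mult.commute)
    qed
    show "AE x in lborel. norm (q n x) \<le> B * indicator (cball 0 (R + 1)) x" for n
    proof (rule AE_I2)
      fix x
      let ?h = "1 / real (Suc n)"
      show "norm (q n x) \<le> B * indicator (cball 0 (R + 1)) x"
      proof (cases "x \<in> cball 0 (R + 1)")
        case True
        have "norm (q n x) \<le> real (Suc n) * (B * ?h)"
          unfolding q_def abs_mult real_norm_def
          using lip[of ?h x] by (intro mult_mono) auto
        also have "\<dots> = B" by (simp del: of_nat_Suc)
        finally show ?thesis using True by simp
      next
        case False
        then have "R + 1 < norm x" by simp
        moreover have "norm x \<le> norm (x + ?h *\<^sub>R e) + norm (?h *\<^sub>R e)"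
          by (metis add_diff_cancel norm_triangle_ineq4)
        moreover have "norm (?h *\<^sub>R e) \<le> 1" using e by simp
        ultimately have "R < norm x" "R < norm (x + ?h *\<^sub>R e)" by linarith+
        then have "x \<notin> C" "x + ?h *\<^sub>R e \<notin> C" using R by force+
        then show ?thesis using False C(3) by (simp add: q_def)
      qed
    qed
  qed (simp_all add: q_def)
  moreover have "(LINT x|lborel. q n x) = 0" for n
  proof -
    let ?h = "(1 / real (Suc n)) *\<^sub>R e"
    have d: "distr lborel borel ((+) ?h) = lborel" by (rule lborel_distr_plus)
    have "integrable lborel (\<lambda>x. \<phi> (?h + x))"
      using test_fun_integrable[OF \<phi>]
      by (subst (asm) d[symmetric]) (simp add: integrable_distr_eq)
    moreover have "(LINT x|lborel. \<phi> (?h + x)) = (LINT x|lborel. \<phi> x)"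
      by (subst (2) d[symmetric]) (simp add: integral_distr)
    ultimately show ?thesis
      using test_fun_integrable[OF \<phi>] by (simp add: q_def add.commute)
  qed
  ultimately show ?thesis by (simp add: LIMSEQ_const_iff)
qed

lemma integral_by_parts:
  assumes \<phi>: "test_fun UNIV \<phi>" and \<psi>: "test_fun UNIV \<psi>"
  shows "(LINT x|lborel. partial_deriv j \<phi> x * \<psi> x) = - (LINT x|lborel. \<phi> x * partial_deriv j \<psi> x)"
proof -
  have 1: "integrable lborel (\<lambda>x. partial_deriv j \<phi> x * \<psi> x)"
    using \<phi> \<psi> by (intro test_fun_integrable[of UNIV] test_fun_mult test_fun_partial_deriv test_fun_C_fun)
  have 2: "integrable lborel (\<lambda>x. \<phi> x * partial_deriv j \<psi> x)"
    by (intro test_fun_integrable[of UNIV] test_fun_mult \<phi> test_fun_C_fun[OF test_fun_partial_deriv[OF \<psi>]])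
  have "0 = (LINT x|lborel. partial_deriv j (\<lambda>x. \<phi> x * \<psi> x) x)"
    using integral_partial_deriv[OF test_fun_mult[OF \<phi> test_fun_C_fun[OF \<psi>]]] by simp
  also have "\<dots> = (LINT x|lborel. \<phi> x * partial_deriv j \<psi> x + partial_deriv j \<phi> x * \<psi> x)"
    using \<phi> \<psi> by (simp add: partial_deriv_mult test_fun_differentiable[of UNIV])
  also have "\<dots> = (LINT x|lborel. \<phi> x * partial_deriv j \<psi> x) + (LINT x|lborel. partial_deriv j \<phi> x * \<psi> x)"
    using 1 2 by simp
  finally show ?thesis by simp
qed

section \<open>Null boundaries of Lipschitz domains\<close>

lemma open_sets_lebesgue: "open S \<Longrightarrow> S \<in> sets lebesgue"
  by (simp add: sets_completionI_sets)

lemma lipschitz_domain_open: "lipschitz_domain D \<Longrightarrow> open D"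
  by (simp add: lipschitz_domain_def)

text \<open>The graph is the image of the hyperplane orthogonal to \<open>e\<close> under the
  Lipschitz map y + g(y) e, and Lipschitz maps of the space preserve null sets.\<close>

lemma negligible_lipschitz_graph:
  fixes e :: "'a::euclidean_space"
  assumes e: "norm e = 1" and g: "L-lipschitz_on UNIV (g :: 'a \<Rightarrow> real)"
  shows "negligible {x. x \<bullet> e = g (x - (x \<bullet> e) *\<^sub>R e)}"
proof -
  let ?f = "\<lambda>y. y + g y *\<^sub>R e"
  have "negligible (?f ` {y. e \<bullet> y = 0})"
  proof (rule negligible_locally_Lipschitz_image)
    show "negligible {y. e \<bullet> y = 0}"
      using e by (intro negligible_hyperplane) auto
    fix x :: 'a
    have "norm (?f y - ?f x) \<le> (1 + L) * norm (y - x)" for y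
    proof -
      have "?f y - ?f x = (y - x) + (g y - g x) *\<^sub>R e" by (simp add: algebra_simps)
      then have "norm (?f y - ?f x) \<le> norm (y - x) + norm ((g y - g x) *\<^sub>R e)"
        by (metis norm_triangle_ineq)
      also have "\<dots> \<le> norm (y - x) + L * norm (y - x)"
        using lipschitz_onD[OF g, of y x] e by (simp add: dist_norm)
      finally show ?thesis by (simp add: algebra_simps)
    qed
    then show "\<exists>T B. open T \<and> x \<in> T \<and>
        (\<forall>y\<in>{y. e \<bullet> y = 0} \<inter> T. norm (?f y - ?f x) \<le> B * norm (y - x))"
      by (intro exI[of _ UNIV] exI[of _ "1 + L"]) auto
  qed simp
  moreover have "{x. x \<bullet> e = g (x - (x \<bullet> e) *\<^sub>R e)} \<subseteq> ?f ` {y. e \<bullet> y = 0}"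
  proof
    fix x assume x: "x \<in> {x. x \<bullet> e = g (x - (x \<bullet> e) *\<^sub>R e)}"
    let ?y = "x - (x \<bullet> e) *\<^sub>R e"
    have "e \<bullet> e = 1" using e by (simp add: norm_eq_sqrt_inner)
    then have "e \<bullet> ?y = 0" by (simp add: inner_diff_right inner_commute)
    moreover have "x = ?f ?y" using x by simp
    ultimately show "x \<in> ?f ` {y. e \<bullet> y = 0}" by blast
  qed
  ultimately show ?thesis by (rule negligible_subset)
qed

text \<open>Negligibility is local. Inside a chart the strict epigraph is \<open>D\<close>, which is
  open and misses its frontier; the strict hypograph is open and disjoint from \<open>D\<close>,
  hence misses the closure. Only the graph is left.\<close>

lemma negligible_frontier_lipschitz_domain:
  fixes D :: "'a::euclidean_space set"
  assumes "lipschitz_domain D"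
  shows "negligible (frontier D)"
proof (subst locally_negligible_alt, rule ballI)
  fix p assume p: "p \<in> frontier D"
  then have "\<exists>U e g L. open U \<and> p \<in> U \<and> norm e = 1 \<and> L-lipschitz_on UNIV (g :: 'a \<Rightarrow> real) \<and>
      D \<inter> U = {x \<in> U. g (x - (x \<bullet> e) *\<^sub>R e) < x \<bullet> e}"
    using assms unfolding lipschitz_domain_def by (elim conjE) (erule (1) bspec)
  then obtain U e g L where U: "open U" "p \<in> U" and e: "norm e = 1"
    and g: "L-lipschitz_on UNIV (g :: 'a \<Rightarrow> real)"
    and DU: "D \<inter> U = {x \<in> U. g (x - (x \<bullet> e) *\<^sub>R e) < x \<bullet> e}"
    by (elim exE conjE)
  have "frontier D \<inter> U \<subseteq> {x. x \<bullet> e = g (x - (x \<bullet> e) *\<^sub>R e)}"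
  proof
    fix x assume "x \<in> frontier D \<inter> U"
    then have x: "x \<in> closure D" "x \<notin> D" "x \<in> U"
      using lipschitz_domain_open[OF assms] by (auto simp: frontier_def interior_open)
    let ?V = "U \<inter> {y. y \<bullet> e < g (y - (y \<bullet> e) *\<^sub>R e)}"
    have "continuous_on UNIV (\<lambda>y. g (y - (y \<bullet> e) *\<^sub>R e))"
      by (intro continuous_on_compose2[OF lipschitz_on_continuous_on[OF g]] continuous_intros) auto
    then have "open ?V"
      using U by (intro open_Int open_Collect_less continuous_intros) auto
    moreover have "?V \<inter> D = {}" using DU by force
    ultimately have "?V \<inter> closure D = {}" by (simp add: open_Int_closure_eq_empty)
    then have "\<not> x \<bullet> e < g (x - (x \<bullet> e) *\<^sub>R e)" using x by blast
    moreover have "\<not> g (x - (x \<bullet> e) *\<^sub>R e) < x \<bullet> e" using x DU by blast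
    ultimately show "x \<in> {x. x \<bullet> e = g (x - (x \<bullet> e) *\<^sub>R e)}" by simp
  qed
  then have "negligible (frontier D \<inter> U)"
    using negligible_lipschitz_graph[OF e g] negligible_subset by blast
  then show "\<exists>V. openin (top_of_set (frontier D)) V \<and> p \<in> V \<and> negligible V"
    using U p by (intro exI[of _ "frontier D \<inter> U"]) auto
qed

section \<open>Decompositions up to null sets\<close>

lemma decomposition_subdomain:
  assumes "decomposition \<Omega> T" "K \<in> T"
  shows "open K" "K \<subseteq> \<Omega>" "K \<in> sets lebesgue"
proof -
  show "open K" "K \<subseteq> \<Omega>"
    using assms lipschitz_domain_open by (auto simp: decomposition_def)
  then show "K \<in> sets lebesgue" by (intro open_sets_lebesgue)
qed

text \<open>A point of \<open>\<Omega>\<close> in no subdomain lies in the closure of some open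
  \<open>K\<close> without lying in \<open>K\<close>, hence on a frontier; there are finitely many
  of these.\<close>

lemma decomposition_AE:
  assumes "decomposition \<Omega> T"
  shows "AE x in lebesgue. x \<in> \<Omega> \<longrightarrow> (\<exists>K\<in>T. x \<in> K)"
proof (rule AE_I')
  have T: "finite T" "\<Omega> \<subseteq> (\<Union>K\<in>T. closure K)"
    using assms by (auto simp: decomposition_def)
  show "(\<Union>K\<in>T. frontier K) \<in> null_sets lebesgue"
    unfolding negligible_iff_null_sets[symmetric]
    using assms T by (auto simp: decomposition_def intro!: negligible_Union negligible_frontier_lipschitz_domain)
  show "{x \<in> space lebesgue. \<not> (x \<in> \<Omega> \<longrightarrow> (\<exists>K\<in>T. x \<in> K))} \<subseteq> (\<Union>K\<in>T. frontier K)"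
    using T decomposition_subdomain(1)[OF assms] by (fastforce simp: frontier_def interior_open)
qed

text \<open>Almost every point of \<open>\<Omega>\<close> lies in exactly one subdomain, by
  \<open>decomposition_AE\<close> and disjointness, so a single term of the sum survives
  there.\<close>

lemma sum_restr:
  assumes T: "decomposition \<Omega> T" and v: "vanishes_off \<Omega> v"
  shows "(\<Sum>K\<in>T. restr K v) = v"
proof (rule l2_eqI)
  have fin: "finite T" and disj: "disjoint T"
    using T by (auto simp: decomposition_def)
  have "AE x in lebesgue. \<forall>K\<in>T. rep_l2 (restr K v) x = indicator K x *\<^sub>R rep_l2 v x"
    using fin decomposition_subdomain[OF T] by (intro AE_finite_allI rep_restr) auto
  then show "AE x in lebesgue. rep_l2 (\<Sum>K\<in>T. restr K v) x = rep_l2 v x"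
    using rep_l2_sum[OF fin, of "\<lambda>K. restr K v"] decomposition_AE[OF T] v[unfolded vanishes_off_def]
  proof eventually_elim
    case (elim x)
    have "(\<Sum>K\<in>T. rep_l2 (restr K v) x) = (\<Sum>K\<in>T. indicator K x *\<^sub>R rep_l2 v x)"
      using elim(1) by (intro sum.cong) auto
    also have "\<dots> = rep_l2 v x"
    proof (cases "x \<in> \<Omega>")
      case True
      with elim obtain K where K: "K \<in> T" "x \<in> K" by blast
      then have "x \<notin> K'" if "K' \<in> T" "K' \<noteq> K" for K'
        using disj that by (auto simp: disjoint_def)
      then have "(\<Sum>K\<in>T. indicator K x *\<^sub>R rep_l2 v x) = (\<Sum>K'\<in>{K}. indicator K' x *\<^sub>R rep_l2 v x)"
        using K fin by (intro sum.mono_neutral_right) auto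
      then show ?thesis using K by simp
    qed (use elim in simp)
    finally show ?case using elim by simp
  qed
qed

lemma form_inner_eq_broken_inner:
  assumes T: "decomposition \<Omega> T" and \<Omega>: "\<Omega> \<in> sets lebesgue"
  shows "form_inner \<Omega> v w = broken_inner T v w"
proof -
  note K = decomposition_subdomain[OF T]
  \<comment> \<open>\<open>v\<close> may be nonzero off \<open>\<Omega>\<close>, so
    \<open>sum_restr\<close> is applied to \<open>restr \<Omega> v\<close>; both sides of the claim
    see only this restriction.\<close>
  have "restr K (restr \<Omega> v) = restr K v" if "K \<in> T" for K
  proof (rule l2_eqI)
    show "AE x in lebesgue. rep_l2 (restr K (restr \<Omega> v)) x = rep_l2 (restr K v) x"
      using rep_restr[OF \<Omega>, of v] rep_restr[OF K(3)[OF that], of v]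
        rep_restr[OF K(3)[OF that], of "restr \<Omega> v"]
      by eventually_elim (use K(2)[OF that] in \<open>auto simp: indicator_def\<close>)
  qed
  then have "(\<Sum>K\<in>T. restr K v) = restr \<Omega> v"
    using sum_restr[OF T vanishes_off_restr[OF \<Omega>, of v]] by simp
  then have "form_inner \<Omega> v w = form_inner \<Omega> (\<Sum>K\<in>T. restr K v) w"
    by (simp add: form_inner_restr_left \<Omega>)
  also have "\<dots> = (\<Sum>K\<in>T. form_inner \<Omega> w (restr K v))"
    using \<Omega> by (simp add: form_inner_sum_right form_inner_commute[of \<Omega> _ w])
  also have "\<dots> = (\<Sum>K\<in>T. form_inner K w (restr K v))"
    using K \<Omega> by (intro sum.cong refl form_inner_vanishes_off vanishes_off_restr)
  also have "\<dots> = (\<Sum>K\<in>T. form_inner K (restr K v) (restr K w))"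
    using K by (intro sum.cong refl)
      (metis form_inner_restr_left form_inner_restr_right form_inner_commute)
  also have "\<dots> = broken_inner T v w"
    by (simp add: broken_inner_def)
  finally show ?thesis .
qed

section \<open>The fundamental lemma of the calculus of variations\<close>

text \<open>Open boxes are an intersection-stable generator of the Borel sets, so a Dynkin argument
  spreads the zero integral to all Borel sets, where it determines the density.\<close>

lemma AE_zero_if_box_integrals_zero:
  fixes g :: "'a::euclidean_space \<Rightarrow> real"
  assumes g: "integrable lebesgue g"
    and box: "\<And>a b. (LINT x:box a b|lebesgue. g x) = 0"
  shows "AE x in lebesgue. g x = 0"
proof -
  \<comment> \<open>Boxes generate the Borel sets but not their completion, so \<open>g\<close> is
    replaced by an almost everywhere equal Borel function.\<close>
  obtain g' where g'[measurable]: "g' \<in> borel_measurable lborel" and "AE x in lborel. g x = g' x"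
    using completion_ex_borel_measurable_real[OF borel_measurable_integrable[OF g]] by blast
  then have eq: "AE x in lebesgue. g x = g' x" by (rule_tac AE_completion)
  have m: "g' \<in> borel_measurable lebesgue" using g' by (rule measurable_completion)
  have i: "integrable lborel g'"
    using integrable_cong_AE[OF borel_measurable_integrable[OF g] m eq] g
    by (simp add: integrable_completion)
  have set_eq: "(LINT x:A|lborel. g' x) = (LINT x:A|lebesgue. g x)" if "A \<in> sets borel" for A
  proof -
    have "(LINT x:A|lborel. g' x) = (LINT x:A|lebesgue. g' x)"
      unfolding set_lebesgue_integral_def using that by (intro integral_completion[symmetric]) auto
    also have "\<dots> = (LINT x:A|lebesgue. g x)"
      by (rule set_lebesgue_integral_cong_AE)
         (use that m borel_measurable_integrable[OF g] eq in \<open>auto elim: eventually_mono\<close>)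
    finally show ?thesis .
  qed
  have int: "set_integrable lborel A g'" if "A \<in> sets borel" for A
    unfolding set_integrable_def using that i by (intro integrable_mult_indicator) auto
  have UN: "(LINT x:(\<Union>i. A i)|lborel. g' x) = (\<Sum>i. LINT x:A i|lborel. g' x)"
    if "disjoint_family A" "range A \<subseteq> sets borel" for A :: "nat \<Rightarrow> _"
    using that int by (intro lebesgue_integral_countable_add) (auto simp: disjoint_family_on_def)
  define bs where "bs n = box (- real n *\<^sub>R One) (real n *\<^sub>R One :: 'a)" for n :: nat
  \<comment> \<open>The complement step of the Dynkin induction needs the integral over the whole
    space, obtained here from growing boxes.\<close>
  have total: "(LINT x|lborel. g' x) = 0"
  proof -
    have "(\<lambda>n. LINT x:bs n|lborel. g' x) \<longlonglongrightarrow> (LINT x:(\<Union>n. bs n)|lborel. g' x)"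
    proof (rule set_integral_cont_up)
      show "incseq bs"
        by (force simp: incseq_def bs_def subset_box mem_box)
    qed (auto simp: bs_def intro: int)
    moreover have "(\<Union>n. bs n) = UNIV"
      unfolding bs_def using UN_box_eq_UNIV by simp
    moreover have "(LINT x:bs n|lborel. g' x) = 0" for n
      by (subst set_eq) (simp_all add: bs_def box)
    ultimately show ?thesis
      by (simp add: LIMSEQ_const_iff set_lebesgue_integral_def)
  qed
  have stable: "Int_stable (range (\<lambda>(a, b). box a b :: 'a set))"
    by (auto simp: Int_stable_def box_Int_box)
  have "(LINT x:A|lborel. g' x) = 0" if "A \<in> sets borel" for A
  proof -
    have "range (\<lambda>(a, b). box a b :: 'a set) \<subseteq> Pow UNIV"
      and "A \<in> sigma_sets UNIV (range (\<lambda>(a, b). box a b :: 'a set))"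
      using that by (simp_all add: borel_eq_box)
    with stable show ?thesis
    proof (induction rule: sigma_sets_induct_disjoint)
      case (basic A)
      then show ?case using box by (auto simp: set_eq)
    next
      case (compl A)
      then have A: "A \<in> sets borel" by (simp add: borel_eq_box)
      have "(LINT x:A \<union> (UNIV - A)|lborel. g' x)
          = (LINT x:A|lborel. g' x) + (LINT x:UNIV - A|lborel. g' x)"
        using A by (intro set_integral_Un int) auto
      then show ?case using compl total by (simp add: set_lebesgue_integral_def)
    next
      case (union A)
      then have "range A \<subseteq> sets borel" by (auto simp: borel_eq_box)
      then show ?case using UN union by simp
    qed (simp add: set_lebesgue_integral_def)
  qed
  then have "AE x in lborel. g' x = 0"
    using i by (intro density_unique_real) auto
  then have "AE x in lebesgue. g' x = 0" by (rule AE_completion)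
  with eq show ?thesis by eventually_elim simp
qed

lemma test_fun_measurable_lebesgue:
  "test_fun K \<phi> \<Longrightarrow> \<phi> \<in> borel_measurable lebesgue"
  by (intro measurable_completion) (simp add: borel_measurable_continuous_onI test_fun_continuous)

text \<open>Bumps give zero integrals over boxes whose closure lies in \<open>K\<close>; cutting
  \<open>g\<close> off to such a box makes its integrals over all boxes vanish, and countably many
  closed boxes exhaust \<open>K\<close>.\<close>

lemma AE_zero_if_test_integrals_zero:
  fixes g :: "real^'n::finite \<Rightarrow> real"
  assumes K: "open K" and g: "g \<in> borel_measurable lebesgue"
    and loc: "\<And>a b. set_integrable lebesgue (cbox a b) g"
    and zero: "\<And>\<phi>. test_fun K \<phi> \<Longrightarrow> (LINT x:K|lebesgue. g x * \<phi> x) = 0"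
  shows "AE x in lebesgue. x \<in> K \<longrightarrow> g x = 0"
proof -
  have K': "K \<in> sets lebesgue" using K by (rule open_sets_lebesgue)
  have 1: "(LINT x:box a b|lebesgue. g x) = 0" if ab: "cbox a b \<subseteq> K" for a b
  proof -
    let ?\<phi> = "\<lambda>n. box_bump a b (1 / real (Suc n))"
    have test: "test_fun K (?\<phi> n)" for n
      using ab by (intro test_fun_box_bump) auto
    have "(\<lambda>n. LINT x|lebesgue. indicator K x *\<^sub>R (g x * ?\<phi> n x))
        \<longlonglongrightarrow> (LINT x|lebesgue. indicator (box a b) x *\<^sub>R g x)"
    proof (rule integral_dominated_convergence)
      show "integrable lebesgue (\<lambda>x. norm (indicator (cbox a b) x *\<^sub>R g x))"
        using loc unfolding set_integrable_def by (rule integrable_norm)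
      show "(\<lambda>x. indicator (box a b) x *\<^sub>R g x) \<in> borel_measurable lebesgue"
        using g by (intro borel_measurable_scaleR borel_measurable_indicator open_sets_lebesgue) auto
      have "?\<phi> n \<in> borel_measurable lebesgue" for n
        using test by (rule test_fun_measurable_lebesgue)
      then show "(\<lambda>x. indicator K x *\<^sub>R (g x * ?\<phi> n x)) \<in> borel_measurable lebesgue" for n
        using g K' by auto
      show "AE x in lebesgue. (\<lambda>n. indicator K x *\<^sub>R (g x * ?\<phi> n x))
          \<longlonglongrightarrow> indicator (box a b) x *\<^sub>R g x"
      proof (rule AE_I2)
        fix x
        have "box a b \<subseteq> K" using ab box_subset_cbox by blast
        moreover have "(\<lambda>n. indicator K x *\<^sub>R (g x * ?\<phi> n x))
            \<longlonglongrightarrow> indicator K x *\<^sub>R (g x * indicator (box a b) x)"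
          by (intro tendsto_intros box_bump_tendsto)
        ultimately show "(\<lambda>n. indicator K x *\<^sub>R (g x * ?\<phi> n x))
            \<longlonglongrightarrow> indicator (box a b) x *\<^sub>R g x"
          by (auto simp: indicator_def split: if_splits)
      qed
      show "AE x in lebesgue. norm (indicator K x *\<^sub>R (g x * ?\<phi> n x))
          \<le> norm (indicator (cbox a b) x *\<^sub>R g x)" for n
      proof (rule AE_I2)
        fix x
        have b: "0 \<le> ?\<phi> n x" "?\<phi> n x \<le> 1"
          using box_bump_bounds[of "1 / real (Suc n)" a b x] by auto
        show "norm (indicator K x *\<^sub>R (g x * ?\<phi> n x)) \<le> norm (indicator (cbox a b) x *\<^sub>R g x)"
        proof (cases "x \<in> cbox a b")
          case True
          have "\<bar>g x\<bar> * ?\<phi> n x \<le> \<bar>g x\<bar> * 1" using b by (intro mult_left_mono) auto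
          then show ?thesis using True b ab by (auto simp: abs_mult indicator_def)
        next
          case False
          then have "x \<notin> box a b" using box_subset_cbox by blast
          then show ?thesis by (simp add: box_bump_eq_0)
        qed
      qed
    qed
    moreover have "(LINT x|lebesgue. indicator K x *\<^sub>R (g x * ?\<phi> n x)) = 0" for n
      using zero[OF test[of n]] by (simp add: set_lebesgue_integral_def)
    ultimately show ?thesis
      by (simp add: LIMSEQ_const_iff set_lebesgue_integral_def)
  qed
  have 2: "AE x in lebesgue. x \<in> cbox a b \<longrightarrow> g x = 0" if ab: "cbox a b \<subseteq> K" for a b
  proof -
    let ?h = "\<lambda>x. indicator (box a b) x *\<^sub>R g x"
    have "set_integrable lebesgue (box a b) g"
      by (rule set_integrable_subset[OF loc _ box_subset_cbox]) (simp add: open_sets_lebesgue)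
    then have "integrable lebesgue ?h" by (simp add: set_integrable_def)
    moreover have "(LINT x:box c d|lebesgue. ?h x) = 0" for c d
    proof -
      \<comment> \<open>The cut-off turns an integral over any box into one over an intersection of
        boxes, again a box, to which the first claim applies.\<close>
      obtain e f where ef: "box c d \<inter> box a b = box e f" by (simp add: box_Int_box)
      have "(LINT x:box c d|lebesgue. ?h x) = (LINT x:box e f|lebesgue. g x)"
        unfolding set_lebesgue_integral_def ef[symmetric]
        by (simp add: indicator_inter_arith mult.assoc)
      also have "\<dots> = 0"
      \<comment> \<open>An empty open box may still have a nonempty \<open>cbox e f\<close> outside
        \<open>K\<close>, so the inclusion required by the first claim is derived only in the other
        case.\<close>
      proof (cases "box e f = {}")
        case True
        then show ?thesis by (simp add: set_lebesgue_integral_def)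
      next
        case False
        have "cbox e f = closure (box e f)" using False by (simp add: closure_box)
        also have "\<dots> \<subseteq> cbox a b"
          using ef box_subset_cbox by (intro closure_minimal) blast+
        finally show ?thesis using ab by (intro 1) blast
      qed
      finally show ?thesis .
    qed
    ultimately have "AE x in lebesgue. ?h x = 0" by (rule AE_zero_if_box_integrals_zero)
    \<comment> \<open>The faces of the box are null, so the open box may be replaced by the closed
      one used in the cover.\<close>
    moreover have "AE x in lebesgue. x \<notin> cbox a b - box a b"
      using negligible_frontier_interval by (intro AE_not_in) (simp add: negligible_iff_null_sets[symmetric])
    ultimately show ?thesis by eventually_elim (auto simp: indicator_def split: if_splits)
  qed
  obtain \<D> where D: "countable \<D>" "\<D> \<subseteq> Pow K" "\<And>X. X \<in> \<D> \<Longrightarrow> \<exists>a b. X = cbox a b" "\<Union>\<D> = K"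
    using open_countable_Union_open_cbox[OF K] by metis
  have "AE x in lebesgue. \<forall>X\<in>\<D>. x \<in> X \<longrightarrow> g x = 0"
    using D(1)
  proof (subst AE_ball_countable, safe)
    fix X assume "X \<in> \<D>"
    then have "X \<subseteq> K" and "\<exists>a b. X = cbox a b" using D by blast+
    with 2 show "AE x in lebesgue. x \<in> X \<longrightarrow> g x = 0" by blast
  qed
  then show ?thesis by eventually_elim (use D(4) in blast)
qed

lemma borel_measurable_rep_l2_nth:
  fixes v :: "('a::euclidean_space, real^'m::finite) l2"
  shows "(\<lambda>x. rep_l2 v x $ i) \<in> borel_measurable lebesgue"
  unfolding cart_eq_inner_axis by (intro borel_measurable_inner borel_measurable_rep_l2) simp

section \<open>Smooth forms and pairings with single coefficients\<close>

definition smooth_form :: "('n::finite set \<Rightarrow> real^'n \<Rightarrow> real) \<Rightarrow> 'n form" where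
  "smooth_form \<phi> = abs_l2 (\<lambda>x. \<chi> I. \<phi> I x)"

lemma test_fun_integrable_lebesgue:
  assumes "test_fun K \<phi>"
  shows "integrable lebesgue \<phi>"
  using test_fun_integrable[OF assms] by (simp add: integrable_completion)

lemma square_integrable_test_funs:
  assumes \<phi>: "\<And>I. test_fun K (\<phi> I)"
  shows "square_integrable (\<lambda>x. \<chi> I. \<phi> I x)"
proof -
  have "continuous_on UNIV (\<lambda>x. \<chi> I. \<phi> I x)"
    using test_fun_continuous[OF \<phi>] by (intro continuous_on_vec_lambda)
  then have "(\<lambda>x. \<chi> I. \<phi> I x) \<in> borel_measurable lebesgue"
    by (intro measurable_completion) (simp add: borel_measurable_continuous_onI)
  moreover have "integrable lebesgue (\<lambda>x. \<Sum>I\<in>UNIV. \<phi> I x * \<phi> I x)"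
    using \<phi> by (intro Bochner_Integration.integrable_sum test_fun_integrable_lebesgue[of K]
        test_fun_mult test_fun_C_fun)
  ultimately show ?thesis
    by (simp add: square_integrable_def power2_norm_eq_inner inner_vec_def)
qed

lemma rep_smooth_form:
  "(\<And>I. test_fun K (\<phi> I)) \<Longrightarrow> AE x in lebesgue. rep_l2 (smooth_form \<phi>) x = (\<chi> I. \<phi> I x)"
  unfolding smooth_form_def by (intro rep_abs_l2 square_integrable_test_funs)

lemma smooth_form_L2\<Lambda>:
  assumes \<phi>: "\<And>I. test_fun K (\<phi> I)" and deg: "\<And>I. int (card I) \<noteq> j \<Longrightarrow> \<phi> I = (\<lambda>x. 0)"
  shows "smooth_form \<phi> \<in> L2\<Lambda> j K"
  unfolding L2\<Lambda>_def vanishes_off_def mem_Collect_eq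
proof (intro conjI allI impI)
  show "AE x in lebesgue. x \<notin> K \<longrightarrow> rep_l2 (smooth_form \<phi>) x = 0"
    using rep_smooth_form[of K \<phi>, OF \<phi>]
    by eventually_elim (simp add: test_fun_eq_0[OF \<phi>] vec_eq_iff)
  show "AE x in lebesgue. rep_l2 (smooth_form \<phi>) x $ I = 0" if "int (card I) \<noteq> j" for I
    using rep_smooth_form[of K \<phi>, OF \<phi>] by eventually_elim (simp add: deg[OF that])
qed

lemma vanishes_off_smooth_form:
  assumes \<phi>: "\<And>I. test_fun K (\<phi> I)"
  shows "vanishes_off K (smooth_form \<phi>)"
  unfolding vanishes_off_def
  using rep_smooth_form[of K \<phi>, OF \<phi>]
  by eventually_elim (simp add: test_fun_eq_0[OF \<phi>] vec_eq_iff)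

lemma form_inner_smooth_form:
  assumes "K \<in> sets lebesgue" and \<phi>: "\<And>I. test_fun S (\<phi> I)"
  shows "form_inner K v (smooth_form \<phi>) = (LINT x:K|lebesgue. \<Sum>I\<in>UNIV. rep_l2 v x $ I * \<phi> I x)"
  unfolding form_inner_eq
proof (rule set_lebesgue_integral_cong_AE)
  have "(\<lambda>x. rep_l2 v x $ I) \<in> borel_measurable lebesgue" for I
    by (rule borel_measurable_rep_l2_nth)
  then show "(\<lambda>x. \<Sum>I\<in>UNIV. rep_l2 v x $ I * \<phi> I x) \<in> borel_measurable lebesgue"
    using test_fun_measurable_lebesgue[OF \<phi>] by (intro borel_measurable_sum borel_measurable_times)
  show "AE x\<in>K in lebesgue. rep_l2 v x \<bullet> rep_l2 (smooth_form \<phi>) x = (\<Sum>I\<in>UNIV. rep_l2 v x $ I * \<phi> I x)"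
    using rep_smooth_form[of S \<phi>, OF \<phi>] by eventually_elim (simp add: inner_vec_def)
qed (use assms in auto)

text \<open>The form \<open>\<phi> dx_J\<close>. Pairing with it extracts one coefficient, which
  turns the coefficientwise integrals of \<open>has_ext_d\<close> into inner products.\<close>

definition monomial_form :: "'n::finite set \<Rightarrow> (real^'n \<Rightarrow> real) \<Rightarrow> 'n form" where
  "monomial_form J \<phi> = smooth_form (\<lambda>I. if I = J then \<phi> else (\<lambda>x. 0))"

lemma test_fun_monomial: "test_fun K \<phi> \<Longrightarrow> test_fun K (if I = J then \<phi> else (\<lambda>x. 0))"
  by (simp add: test_fun_zero)

lemma vanishes_off_monomial_form: "test_fun K \<phi> \<Longrightarrow> vanishes_off K (monomial_form J \<phi>)"
  unfolding monomial_form_def by (intro vanishes_off_smooth_form test_fun_monomial)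

lemma form_inner_monomial_form:
  assumes "K \<in> sets lebesgue" "test_fun S \<phi>"
  shows "form_inner K v (monomial_form J \<phi>) = (LINT x:K|lebesgue. rep_l2 v x $ J * \<phi> x)"
proof -
  have "(\<Sum>I\<in>UNIV. rep_l2 v x $ I * (if I = J then \<phi> else (\<lambda>x. 0)) x) = rep_l2 v x $ J * \<phi> x" for x
  proof -
    have "(\<Sum>I\<in>UNIV. rep_l2 v x $ I * (if I = J then \<phi> else (\<lambda>x. 0)) x)
        = (\<Sum>I\<in>UNIV. if I = J then rep_l2 v x $ I * \<phi> x else 0)"
      by (intro sum.cong) auto
    then show ?thesis by simp
  qed
  then show ?thesis
    unfolding monomial_form_def
    by (subst form_inner_smooth_form[OF assms(1) test_fun_monomial[OF assms(2)]]) simp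
qed

lemma form_inner_monomial_smooth:
  assumes K: "K \<in> sets lebesgue" and \<phi>: "\<And>I. test_fun K (\<phi> I)" and \<psi>: "test_fun K \<psi>"
  shows "form_inner K (smooth_form \<phi>) (monomial_form J \<psi>) = (LINT x|lborel. \<phi> J x * \<psi> x)"
proof -
  have "form_inner K (smooth_form \<phi>) (monomial_form J \<psi>)
      = (LINT x:K|lebesgue. rep_l2 (smooth_form \<phi>) x $ J * \<psi> x)"
    by (rule form_inner_monomial_form[OF K \<psi>])
  also have "\<dots> = (LINT x|lebesgue. \<phi> J x * \<psi> x)"
    unfolding set_lebesgue_integral_def
  proof (rule integral_cong_AE)
    have "(\<lambda>x. rep_l2 (smooth_form \<phi>) x $ J) \<in> borel_measurable lebesgue"
      by (rule borel_measurable_rep_l2_nth)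
    then show "(\<lambda>x. indicator K x *\<^sub>R (rep_l2 (smooth_form \<phi>) x $ J * \<psi> x)) \<in> borel_measurable lebesgue"
      using K test_fun_measurable_lebesgue[OF \<psi>] by auto
    show "(\<lambda>x. \<phi> J x * \<psi> x) \<in> borel_measurable lebesgue"
      using test_fun_measurable_lebesgue[OF \<psi>] test_fun_measurable_lebesgue[OF \<phi>] by auto
    show "AE x in lebesgue. indicator K x *\<^sub>R (rep_l2 (smooth_form \<phi>) x $ J * \<psi> x) = \<phi> J x * \<psi> x"
      using rep_smooth_form[of K \<phi>, OF \<phi>]
      by eventually_elim (auto simp: indicator_def test_fun_eq_0[OF \<psi>])
  qed
  also have "\<dots> = (LINT x|lborel. \<phi> J x * \<psi> x)"
    by (intro integral_completion borel_measurable_times)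
       (simp_all add: borel_measurable_continuous_onI test_fun_continuous[OF \<psi>] test_fun_continuous[OF \<phi>])
  finally show ?thesis .
qed

lemma form_eq_0_if_test_zero:
  assumes K: "open K" and w: "vanishes_off K w"
    and zero: "\<And>J \<phi>. test_fun K \<phi> \<Longrightarrow> form_inner K w (monomial_form J \<phi>) = 0"
  shows "w = 0"
proof (rule l2_eqI)
  have K': "K \<in> sets lebesgue" using K by (rule open_sets_lebesgue)
  have "AE x in lebesgue. x \<in> K \<longrightarrow> rep_l2 w x $ J = 0" for J
  proof (rule AE_zero_if_test_integrals_zero[OF K])
    show m: "(\<lambda>x. rep_l2 w x $ J) \<in> borel_measurable lebesgue"
      by (rule borel_measurable_rep_l2_nth)
    show "set_integrable lebesgue (cbox a b) (\<lambda>x. rep_l2 w x $ J)" for a b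
      unfolding set_integrable_def
    proof (rule Bochner_Integration.integrable_bound)
      \<comment> \<open>On a bounded box the estimate |t| <= 1 + t^2 makes a square-integrable
        coefficient integrable.\<close>
      show "integrable lebesgue (\<lambda>x. indicator (cbox a b) x + (norm (rep_l2 w x))\<^sup>2 :: real)"
        using square_integrable_rep[of w] lmeasurable_cbox[of a b]
        by (intro Bochner_Integration.integrable_add integrable_real_indicator)
           (auto simp: square_integrable_def fmeasurable_def)
      show "(\<lambda>x. indicator (cbox a b) x *\<^sub>R rep_l2 w x $ J) \<in> borel_measurable lebesgue"
        using m by (intro borel_measurable_scaleR borel_measurable_indicator) auto
      show "AE x in lebesgue. norm (indicator (cbox a b) x *\<^sub>R rep_l2 w x $ J)
          \<le> norm (indicator (cbox a b) x + (norm (rep_l2 w x))\<^sup>2 :: real)"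
      proof (rule AE_I2)
        fix x
        have "\<bar>rep_l2 w x $ J\<bar> \<le> norm (rep_l2 w x)" by (rule component_le_norm_cart)
        also have "\<dots> \<le> 1 + (norm (rep_l2 w x))\<^sup>2"
          using sum_squares_bound[of 1 "norm (rep_l2 w x)"] norm_ge_zero[of "rep_l2 w x"]
          unfolding power_one mult_1_right by linarith
        finally show "norm (indicator (cbox a b) x *\<^sub>R rep_l2 w x $ J)
            \<le> norm (indicator (cbox a b) x + (norm (rep_l2 w x))\<^sup>2 :: real)"
          by (auto simp: indicator_def)
      qed
    qed
    show "(LINT x:K|lebesgue. rep_l2 w x $ J * \<phi> x) = 0" if "test_fun K \<phi>" for \<phi>
      using zero[OF that] form_inner_monomial_form[OF K' that] by simp
  qed
  then have "AE x in lebesgue. \<forall>J\<in>UNIV. x \<in> K \<longrightarrow> rep_l2 w x $ J = 0"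
    by (subst AE_finite_all) auto
  moreover have "AE x in lebesgue. rep_l2 (0 :: 'a form) x = 0" by (rule rep_l2_zero)
  ultimately show "AE x in lebesgue. rep_l2 w x = rep_l2 0 x"
    using w[unfolded vanishes_off_def] by eventually_elim (auto simp: vec_eq_iff)
qed

section \<open>The exterior derivative\<close>

text \<open>Every term becomes a \<open>form_inner\<close>, so additivity, restriction and limits of
  weak derivatives reduce to the corresponding facts on inner products.\<close>

lemma has_ext_d_iff:
  assumes "open K"
  shows "has_ext_d K v w \<longleftrightarrow> vanishes_off K w \<and>
     (\<forall>J \<phi>. test_fun K \<phi> \<longrightarrow> form_inner K w (monomial_form J \<phi>) =
        - (\<Sum>j\<in>J. shuffle_sign {j} (J - {j}) *
             form_inner K v (monomial_form (J - {j}) (partial_deriv j \<phi>))))"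
proof -
  have "form_inner K u (monomial_form J \<phi>) = (LINT x:K|lebesgue. rep_l2 u x $ J * \<phi> x)"
    and "form_inner K u (monomial_form J (partial_deriv j \<phi>))
      = (LINT x:K|lebesgue. rep_l2 u x $ J * partial_deriv j \<phi> x)"
    if "test_fun K \<phi>" for u J j \<phi>
    using form_inner_monomial_form[OF open_sets_lebesgue[OF assms]] that test_fun_partial_deriv[OF that]
    by blast+
  then show ?thesis unfolding has_ext_d_def by simp
qed

lemma has_ext_d_add:
  assumes K: "open K" and "has_ext_d K v w" "has_ext_d K v' w'"
  shows "has_ext_d K (v + v') (w + w')"
  using assms(2,3) unfolding has_ext_d_iff[OF K]
  by (simp add: vanishes_off_add form_inner_add_left open_sets_lebesgue[OF K] sum.distrib distrib_left)

lemma has_ext_d_scaleR: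
  assumes K: "open K" and "has_ext_d K v w"
  shows "has_ext_d K (c *\<^sub>R v) (c *\<^sub>R w)"
  using assms(2) unfolding has_ext_d_iff[OF K]
  by (simp add: vanishes_off_scaleR form_inner_scaleR_left open_sets_lebesgue[OF K]
      sum_distrib_left mult.left_commute)

text \<open>By linearity the difference of two derivatives of \<open>v\<close> is a derivative of 0,
  hence orthogonal to all coefficient forms. This gives the \<open>THE\<close> in
  \<open>ext_d\<close> its meaning.\<close>

lemma has_ext_d_unique:
  assumes K: "open K" and d: "has_ext_d K v w" "has_ext_d K v w'"
  shows "w = w'"
proof -
  have "has_ext_d K (v + (- 1) *\<^sub>R v) (w + (- 1) *\<^sub>R w')"
    by (intro has_ext_d_add has_ext_d_scaleR K d)
  then have "has_ext_d K 0 (w - w')" by simp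
  then have "w - w' = 0"
    unfolding has_ext_d_iff[OF K]
    by (intro form_eq_0_if_test_zero[OF K]) (simp_all add: open_sets_lebesgue[OF K])
  then show ?thesis by simp
qed

lemma ext_d_eq: "open K \<Longrightarrow> has_ext_d K v w \<Longrightarrow> ext_d K v = w"
  unfolding ext_d_def by (blast intro: the_equality has_ext_d_unique)

lemma H\<Lambda>_ext_d:
  assumes "open K" "v \<in> H\<Lambda> j K"
  shows "has_ext_d K v (ext_d K v)" "ext_d K v \<in> L2\<Lambda> (j + 1) K"
  using assms ext_d_eq unfolding H\<Lambda>_def by blast+

lemma H\<Lambda>_I: "v \<in> L2\<Lambda> j K \<Longrightarrow> has_ext_d K v w \<Longrightarrow> w \<in> L2\<Lambda> (j + 1) K \<Longrightarrow> v \<in> H\<Lambda> j K"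
  by (auto simp: H\<Lambda>_def)

lemma H\<Lambda>_L2\<Lambda>: "v \<in> H\<Lambda> j K \<Longrightarrow> v \<in> L2\<Lambda> j K"
  by (simp add: H\<Lambda>_def)

lemma subspace_H\<Lambda>:
  assumes K: "open K"
  shows "subspace (H\<Lambda> j K)"
proof (rule subspaceI)
  have "has_ext_d K 0 0"
    by (simp add: has_ext_d_iff[OF K] open_sets_lebesgue[OF K])
  then show "0 \<in> H\<Lambda> j K"
    by (intro H\<Lambda>_I[of 0 j K 0]) (auto intro: subspace_0 subspace_L2\<Lambda>)
  show "v + w \<in> H\<Lambda> j K" if "v \<in> H\<Lambda> j K" "w \<in> H\<Lambda> j K" for v w
    using that H\<Lambda>_ext_d[OF K]
    by (intro H\<Lambda>_I[OF _ has_ext_d_add[OF K]]) (auto intro: subspace_add subspace_L2\<Lambda> H\<Lambda>_L2\<Lambda>)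
  show "c *\<^sub>R v \<in> H\<Lambda> j K" if "v \<in> H\<Lambda> j K" for c v
    using that H\<Lambda>_ext_d[OF K]
    by (intro H\<Lambda>_I[OF _ has_ext_d_scaleR[OF K]]) (auto intro: subspace_scale subspace_L2\<Lambda> H\<Lambda>_L2\<Lambda>)
qed

lemma ext_d_add:
  "open K \<Longrightarrow> v \<in> H\<Lambda> j K \<Longrightarrow> w \<in> H\<Lambda> j K \<Longrightarrow> ext_d K (v + w) = ext_d K v + ext_d K w"
  by (intro ext_d_eq has_ext_d_add H\<Lambda>_ext_d)

lemma ext_d_scaleR: "open K \<Longrightarrow> v \<in> H\<Lambda> j K \<Longrightarrow> ext_d K (c *\<^sub>R v) = c *\<^sub>R ext_d K v"
  by (intro ext_d_eq has_ext_d_scaleR H\<Lambda>_ext_d)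

lemma ext_d_zero: "open K \<Longrightarrow> ext_d K 0 = 0"
  using ext_d_scaleR[of K 0 0 0] subspace_0[OF subspace_H\<Lambda>] by force

lemma ext_d_diff:
  assumes "open K" "v \<in> H\<Lambda> j K" "w \<in> H\<Lambda> j K"
  shows "ext_d K (v - w) = ext_d K v - ext_d K w"
  using ext_d_add[of K "v - w" j w] assms by (simp add: subspace_diff subspace_H\<Lambda>)

text \<open>Test functions on \<open>K\<close> are test functions on \<open>\<Omega>\<close>, so the
  local identity is the global one tested with fewer functions.\<close>

lemma has_ext_d_restr:
  assumes K: "open K" and \<Omega>: "open \<Omega>" and sub: "K \<subseteq> \<Omega>" and d: "has_ext_d \<Omega> v w"
  shows "has_ext_d K (restr K v) (restr K w)"
proof -
  note K' = open_sets_lebesgue[OF K] and \<Omega>' = open_sets_lebesgue[OF \<Omega>]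
  have eq: "form_inner K (restr K u) (monomial_form J \<phi>) = form_inner \<Omega> u (monomial_form J \<phi>)"
    if "test_fun K \<phi>" for u J \<phi>
    using form_inner_vanishes_off[OF sub K' \<Omega>' vanishes_off_monomial_form[OF that]]
    by (simp add: form_inner_restr_left K')
  show ?thesis
    using d unfolding has_ext_d_iff[OF K] has_ext_d_iff[OF \<Omega>]
    by (simp add: eq test_fun_partial_deriv test_fun_mono[OF _ sub] vanishes_off_restr K')
qed

text \<open>The coefficients of the classical exterior derivative, with the signs of
  \<open>has_ext_d\<close>.\<close>

definition smooth_d :: "('n::{finite,linorder} set \<Rightarrow> (real, 'n) vec \<Rightarrow> real)
    \<Rightarrow> 'n set \<Rightarrow> (real, 'n) vec \<Rightarrow> real" where
  "smooth_d \<phi> J = (\<lambda>x. \<Sum>j\<in>J. shuffle_sign {j} (J - {j}) * partial_deriv j (\<phi> (J - {j})) x)"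

lemma test_fun_smooth_d:
  "(\<And>I. test_fun K (\<phi> I)) \<Longrightarrow> test_fun K (smooth_d \<phi> J)"
  unfolding smooth_d_def by (intro test_fun_sum test_fun_scale test_fun_partial_deriv) auto

text \<open>Integration by parts in each coefficient: both factors have compact support in
  \<open>K\<close>, so the integrals extend to the whole space and no boundary terms appear.\<close>

lemma has_ext_d_smooth_form:
  assumes K: "open K" and \<phi>: "\<And>I. test_fun K (\<phi> I)"
  shows "has_ext_d K (smooth_form \<phi>) (smooth_form (smooth_d \<phi>))"
  unfolding has_ext_d_iff[OF K]
proof (intro conjI allI impI)
  show "vanishes_off K (smooth_form (smooth_d \<phi>))"
    by (intro vanishes_off_smooth_form test_fun_smooth_d \<phi>)
  fix J \<psi> assume \<psi>: "test_fun K \<psi>"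
  note K' = open_sets_lebesgue[OF K]
  have U: "test_fun UNIV \<psi>" "test_fun UNIV (\<phi> I)" for I
    using \<psi> \<phi> by (auto intro: test_fun_mono)
  have "form_inner K (smooth_form (smooth_d \<phi>)) (monomial_form J \<psi>)
      = (LINT x|lborel. smooth_d \<phi> J x * \<psi> x)"
    by (intro form_inner_monomial_smooth K' test_fun_smooth_d \<phi> \<psi>)
  also have "\<dots> = (LINT x|lborel. (\<Sum>j\<in>J. shuffle_sign {j} (J - {j}) *
      (partial_deriv j (\<phi> (J - {j})) x * \<psi> x)))"
    by (simp add: smooth_d_def sum_distrib_right mult.assoc)
  also have "\<dots> = (\<Sum>j\<in>J. shuffle_sign {j} (J - {j}) *
      (LINT x|lborel. partial_deriv j (\<phi> (J - {j})) x * \<psi> x))"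
    using \<phi> \<psi> by (subst Bochner_Integration.integral_sum)
      (auto intro!: integrable_mult_right test_fun_integrable[of K] test_fun_mult
         test_fun_partial_deriv test_fun_C_fun[of K])
  also have "\<dots> = (\<Sum>j\<in>J. - (shuffle_sign {j} (J - {j}) *
      (LINT x|lborel. \<phi> (J - {j}) x * partial_deriv j \<psi> x)))"
    by (simp add: integral_by_parts[OF U(2) U(1)])
  also have "\<dots> = - (\<Sum>j\<in>J. shuffle_sign {j} (J - {j}) *
      form_inner K (smooth_form \<phi>) (monomial_form (J - {j}) (partial_deriv j \<psi>)))"
    by (simp add: sum_negf form_inner_monomial_smooth[OF K' \<phi> test_fun_partial_deriv[OF \<psi>]])
  finally show "form_inner K (smooth_form (smooth_d \<phi>)) (monomial_form J \<psi>)
      = - (\<Sum>j\<in>J. shuffle_sign {j} (J - {j}) *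
        form_inner K (smooth_form \<phi>) (monomial_form (J - {j}) (partial_deriv j \<psi>)))" .
qed

lemma smooth_d_degree:
  assumes deg: "\<And>I. int (card I) \<noteq> j \<Longrightarrow> \<phi> I = (\<lambda>x. 0)" and J: "int (card J) \<noteq> j + 1"
  shows "smooth_d \<phi> J = (\<lambda>x. 0)"
proof -
  have "partial_deriv i (\<phi> (J - {i})) x = 0" if "i \<in> J" for i x
  proof -
    \<comment> \<open>Positivity keeps the natural-number subtraction in
      \<open>card (J - {i})\<close> from truncating.\<close>
    have "card J > 0" using that by (auto simp: card_gt_0_iff)
    then have "int (card (J - {i})) \<noteq> j" using that J by (auto simp: card_Diff_singleton)
    then show ?thesis using deg by (simp add: partial_deriv_eq[OF has_derivative_const])
  qed
  then show ?thesis by (simp add: smooth_d_def fun_eq_iff)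
qed

text \<open>One and the same \<open>w\<close> serves on \<open>K\<close> and on every larger open
  set: the smooth case of extension by zero.\<close>

lemma test_forms_has_ext_d:
  assumes "v \<in> test_forms j K"
  obtains w where "w \<in> L2\<Lambda> (j + 1) K" "\<And>\<Omega>. open \<Omega> \<Longrightarrow> K \<subseteq> \<Omega> \<Longrightarrow> has_ext_d \<Omega> v w"
proof -
  obtain \<phi> where v: "v = smooth_form \<phi>" and \<phi>: "\<And>I. test_fun K (\<phi> I)"
    and deg: "\<And>I. int (card I) \<noteq> j \<Longrightarrow> \<phi> I = (\<lambda>x. 0)"
    using assms unfolding test_forms_def smooth_form_def by blast
  show ?thesis
  proof
    show "smooth_form (smooth_d \<phi>) \<in> L2\<Lambda> (j + 1) K"
      using smooth_d_degree[OF deg] by (intro smooth_form_L2\<Lambda> test_fun_smooth_d \<phi>) auto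
    show "has_ext_d \<Omega> v (smooth_form (smooth_d \<phi>))" if "open \<Omega>" "K \<subseteq> \<Omega>" for \<Omega>
      unfolding v using that \<phi> by (intro has_ext_d_smooth_form) (auto intro: test_fun_mono)
  qed
qed

lemma test_forms_L2\<Lambda>: "v \<in> test_forms j K \<Longrightarrow> v \<in> L2\<Lambda> j K"
  unfolding test_forms_def smooth_form_def[symmetric] by (auto intro: smooth_form_L2\<Lambda>)

lemma test_forms_H\<Lambda>: "open K \<Longrightarrow> v \<in> test_forms j K \<Longrightarrow> v \<in> H\<Lambda> j K"
  by (metis H\<Lambda>_I test_forms_L2\<Lambda> test_forms_has_ext_d order_refl)

section \<open>Linear structure of test forms and of their graph-norm closure\<close>

lemma smooth_form_add:
  assumes \<phi>: "\<And>I. test_fun K (\<phi> I)" and \<psi>: "\<And>I. test_fun K (\<psi> I)"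
  shows "smooth_form \<phi> + smooth_form \<psi> = smooth_form (\<lambda>I x. \<phi> I x + \<psi> I x)"
proof (rule l2_eqI)
  have "AE x in lebesgue. rep_l2 (smooth_form (\<lambda>I x. \<phi> I x + \<psi> I x)) x = (\<chi> I. \<phi> I x + \<psi> I x)"
    by (intro rep_smooth_form[of K] test_fun_add \<phi> \<psi>)
  with rep_l2_add[of "smooth_form \<phi>" "smooth_form \<psi>"]
    rep_smooth_form[of K \<phi>, OF \<phi>] rep_smooth_form[of K \<psi>, OF \<psi>]
  show "AE x in lebesgue. rep_l2 (smooth_form \<phi> + smooth_form \<psi>) x
      = rep_l2 (smooth_form (\<lambda>I x. \<phi> I x + \<psi> I x)) x"
    by eventually_elim (simp add: vec_eq_iff)
qed

lemma smooth_form_scaleR: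
  assumes \<phi>: "\<And>I. test_fun K (\<phi> I)"
  shows "c *\<^sub>R smooth_form \<phi> = smooth_form (\<lambda>I x. c * \<phi> I x)"
proof (rule l2_eqI)
  have "AE x in lebesgue. rep_l2 (smooth_form (\<lambda>I x. c * \<phi> I x)) x = (\<chi> I. c * \<phi> I x)"
    by (intro rep_smooth_form[of K] test_fun_scale \<phi>)
  with rep_l2_scaleR[of c "smooth_form \<phi>"] rep_smooth_form[of K \<phi>, OF \<phi>]
  show "AE x in lebesgue. rep_l2 (c *\<^sub>R smooth_form \<phi>) x = rep_l2 (smooth_form (\<lambda>I x. c * \<phi> I x)) x"
    by eventually_elim (simp add: vec_eq_iff)
qed

lemma subspace_test_forms: "subspace (test_forms j K)"
proof (rule subspaceI)
  have *: "smooth_form \<phi> \<in> test_forms j K"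
    if "\<And>I. test_fun K (\<phi> I)" "\<And>I. int (card I) \<noteq> j \<Longrightarrow> \<phi> I = (\<lambda>x. 0)" for \<phi>
    using that unfolding test_forms_def smooth_form_def by blast
  show "v + w \<in> test_forms j K" if vw: "v \<in> test_forms j K" "w \<in> test_forms j K" for v w
  proof -
    from vw obtain \<phi> \<psi> where eq: "v = smooth_form \<phi>" "w = smooth_form \<psi>"
      and test: "\<And>I. test_fun K (\<phi> I)" "\<And>I. test_fun K (\<psi> I)"
      and deg: "\<And>I. int (card I) \<noteq> j \<Longrightarrow> \<phi> I = (\<lambda>x. 0)" "\<And>I. int (card I) \<noteq> j \<Longrightarrow> \<psi> I = (\<lambda>x. 0)"
      unfolding test_forms_def smooth_form_def[symmetric] by blast
    have "v + w = smooth_form (\<lambda>I x. \<phi> I x + \<psi> I x)"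
      unfolding eq by (rule smooth_form_add[OF test])
    then show ?thesis using test deg by (auto intro!: * test_fun_add)
  qed
  show scale: "c *\<^sub>R v \<in> test_forms j K" if v: "v \<in> test_forms j K" for c v
  proof -
    from v obtain \<phi> where eq: "v = smooth_form \<phi>" and test: "\<And>I. test_fun K (\<phi> I)"
      and deg: "\<And>I. int (card I) \<noteq> j \<Longrightarrow> \<phi> I = (\<lambda>x. 0)"
      unfolding test_forms_def smooth_form_def[symmetric] by blast
    have "c *\<^sub>R v = smooth_form (\<lambda>I x. c * \<phi> I x)"
      unfolding eq by (rule smooth_form_scaleR[OF test])
    then show ?thesis using test deg by (auto intro!: * test_fun_scale)
  qed
  have "smooth_form (\<lambda>I x. 0) \<in> test_forms j K"
    by (intro *) (auto intro: test_fun_zero)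
  from scale[OF this, of 0] show "0 \<in> test_forms j K" by simp
qed

lemma graph_norm_add_le:
  assumes K: "open K" and "v \<in> H\<Lambda> j K" "w \<in> H\<Lambda> j K"
  shows "(graph_norm K (v + w))\<^sup>2 \<le> 2 * (graph_norm K v)\<^sup>2 + 2 * (graph_norm K w)\<^sup>2"
  using form_inner_add_self_le[OF open_sets_lebesgue[OF K], of v w]
    form_inner_add_self_le[OF open_sets_lebesgue[OF K], of "ext_d K v" "ext_d K w"]
  by (simp add: graph_norm_def form_inner_nonneg ext_d_add[OF assms])

lemma graph_norm_scaleR:
  assumes K: "open K" and "v \<in> H\<Lambda> j K"
  shows "graph_norm K (c *\<^sub>R v) = \<bar>c\<bar> * graph_norm K v"
proof -
  note K' = open_sets_lebesgue[OF K]
  have "form_inner K (c *\<^sub>R v) (c *\<^sub>R v) + form_inner K (ext_d K (c *\<^sub>R v)) (ext_d K (c *\<^sub>R v))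
      = c\<^sup>2 * (form_inner K v v + form_inner K (ext_d K v) (ext_d K v))"
    by (simp add: ext_d_scaleR[OF assms] form_inner_scaleR_left[OF K'] form_inner_scaleR_right[OF K']
        power2_eq_square distrib_left mult.assoc)
  then show ?thesis by (simp add: graph_norm_def real_sqrt_mult)
qed

lemma graph_norm_nonneg: "0 \<le> graph_norm K v"
  by (simp add: graph_norm_def form_inner_nonneg)

lemma subspace_H0\<Lambda>:
  assumes K: "open K"
  shows "subspace (H0\<Lambda> j K)"
proof (rule subspaceI)
  note H = subspace_H\<Lambda>[OF K]
  show "0 \<in> H0\<Lambda> j K"
    unfolding H0\<Lambda>_def mem_Collect_eq
  proof (intro conjI allI impI)
    show "0 \<in> H\<Lambda> j K" by (rule subspace_0[OF H])
    show "\<exists>\<phi>\<in>test_forms j K. graph_norm K (0 - \<phi>) < \<epsilon>" if "0 < \<epsilon>" for \<epsilon>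
      using that subspace_0[OF subspace_test_forms]
      by (intro bexI[of _ 0]) (auto simp: graph_norm_def ext_d_zero[OF K] open_sets_lebesgue[OF K])
  qed
  show "v + w \<in> H0\<Lambda> j K" if vw: "v \<in> H0\<Lambda> j K" "w \<in> H0\<Lambda> j K" for v w
    unfolding H0\<Lambda>_def mem_Collect_eq
  proof (intro conjI allI impI)
    have vwH: "v \<in> H\<Lambda> j K" "w \<in> H\<Lambda> j K" using vw by (auto simp: H0\<Lambda>_def)
    then show "v + w \<in> H\<Lambda> j K" by (rule subspace_add[OF H])
    fix \<epsilon> :: real assume \<epsilon>: "0 < \<epsilon>"
    \<comment> \<open>With the factor 2 of the squared inequality, half the tolerance for each
      summand gives exactly 2 (\<epsilon>/2)^2 + 2 (\<epsilon>/2)^2 = \<epsilon>^2.\<close>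
    then have "0 < \<epsilon> / 2" by simp
    with vw obtain \<phi> \<psi> where \<phi>: "\<phi> \<in> test_forms j K" "graph_norm K (v - \<phi>) < \<epsilon> / 2"
      and \<psi>: "\<psi> \<in> test_forms j K" "graph_norm K (w - \<psi>) < \<epsilon> / 2"
      unfolding H0\<Lambda>_def by blast
    have "(graph_norm K ((v - \<phi>) + (w - \<psi>)))\<^sup>2
        \<le> 2 * (graph_norm K (v - \<phi>))\<^sup>2 + 2 * (graph_norm K (w - \<psi>))\<^sup>2"
      using vwH \<phi> \<psi> test_forms_H\<Lambda>[OF K]
      by (intro graph_norm_add_le[OF K, of _ j] subspace_diff[OF H]) auto
    also have "\<dots> < 2 * (\<epsilon> / 2)\<^sup>2 + 2 * (\<epsilon> / 2)\<^sup>2"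
      using \<phi> \<psi> by (intro add_strict_mono mult_strict_left_mono power_strict_mono) (auto simp: graph_norm_nonneg)
    also have "\<dots> = \<epsilon>\<^sup>2" by (simp add: power2_eq_square)
    finally have "graph_norm K (v + w - (\<phi> + \<psi>)) < \<epsilon>"
      using \<epsilon> by (simp add: algebra_simps power2_less_imp_less)
    then show "\<exists>\<phi>\<in>test_forms j K. graph_norm K (v + w - \<phi>) < \<epsilon>"
      using \<phi> \<psi> subspace_add[OF subspace_test_forms] by blast
  qed
  show "c *\<^sub>R v \<in> H0\<Lambda> j K" if v: "v \<in> H0\<Lambda> j K" for c v
    unfolding H0\<Lambda>_def mem_Collect_eq
  proof (intro conjI allI impI)
    have vH: "v \<in> H\<Lambda> j K" using v by (auto simp: H0\<Lambda>_def)
    then show "c *\<^sub>R v \<in> H\<Lambda> j K" by (rule subspace_scale[OF H])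
    fix \<epsilon> :: real assume \<epsilon>: "0 < \<epsilon>"
    \<comment> \<open>The added 1 keeps the tolerance positive for \<open>c = 0\<close>.\<close>
    then have "0 < \<epsilon> / (\<bar>c\<bar> + 1)" by simp
    with v obtain \<phi> where \<phi>: "\<phi> \<in> test_forms j K" "graph_norm K (v - \<phi>) < \<epsilon> / (\<bar>c\<bar> + 1)"
      unfolding H0\<Lambda>_def by blast
    have "graph_norm K (c *\<^sub>R (v - \<phi>)) = \<bar>c\<bar> * graph_norm K (v - \<phi>)"
      using vH \<phi> test_forms_H\<Lambda>[OF K] by (intro graph_norm_scaleR[OF K, of _ j] subspace_diff[OF H]) auto
    also have "\<dots> \<le> (\<bar>c\<bar> + 1) * graph_norm K (v - \<phi>)"
      by (intro mult_right_mono graph_norm_nonneg) simp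
    also have "\<dots> < \<epsilon>" using \<phi>(2) by (simp add: field_simps)
    finally have "graph_norm K (c *\<^sub>R v - c *\<^sub>R \<phi>) < \<epsilon>" by (simp add: scaleR_diff_right)
    then show "\<exists>\<phi>\<in>test_forms j K. graph_norm K (c *\<^sub>R v - \<phi>) < \<epsilon>"
      using \<phi> subspace_scale[OF subspace_test_forms] by blast
  qed
qed

text \<open>Approximating test forms have the same derivative on \<open>K\<close> and on
  \<open>\<Omega>\<close>, and the weak identity on \<open>\<Omega>\<close> is linear and continuous
  in the pair of form and derivative.\<close>

lemma H0\<Lambda>_has_ext_d:
  assumes K: "open K" and \<Omega>: "open \<Omega>" and sub: "K \<subseteq> \<Omega>" and v: "v \<in> H0\<Lambda> j K"
  shows "has_ext_d \<Omega> v (ext_d K v)"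
  unfolding has_ext_d_iff[OF \<Omega>]
proof (intro conjI allI impI)
  note K' = open_sets_lebesgue[OF K] and \<Omega>' = open_sets_lebesgue[OF \<Omega>]
  have vH: "v \<in> H\<Lambda> j K" using v by (simp add: H0\<Lambda>_def)
  have vw: "vanishes_off K v" "vanishes_off K (ext_d K v)"
    using H\<Lambda>_L2\<Lambda>[OF vH] H\<Lambda>_ext_d[OF K vH] by (auto simp: L2\<Lambda>_def)
  then show "vanishes_off \<Omega> (ext_d K v)" using sub vanishes_off_mono by blast
  have "\<exists>\<phi>\<in>test_forms j K. graph_norm K (v - \<phi>) < 1 / real (Suc n)" for n
    using v unfolding H0\<Lambda>_def by simp
  then obtain \<phi> where \<phi>: "\<And>n. \<phi> n \<in> test_forms j K"
    and lim: "\<And>n. graph_norm K (v - \<phi> n) < 1 / real (Suc n)"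
    by metis
  have "\<exists>w. \<forall>n. w n \<in> L2\<Lambda> (j + 1) K \<and> has_ext_d \<Omega> (\<phi> n) (w n) \<and> ext_d K (\<phi> n) = w n"
    by (intro choice allI) (metis \<phi> K \<Omega> sub ext_d_eq order_refl test_forms_has_ext_d)
  then obtain w where w: "\<And>n. w n \<in> L2\<Lambda> (j + 1) K" "\<And>n. has_ext_d \<Omega> (\<phi> n) (w n)"
    "\<And>n. ext_d K (\<phi> n) = w n" by blast
  define a b where "a n = v - \<phi> n" and "b n = ext_d K v - w n" for n
  have ab_eq: "graph_norm K (v - \<phi> n) = sqrt (form_inner K (a n) (a n) + form_inner K (b n) (b n))" for n
    by (simp add: graph_norm_def a_def b_def w(3)[symmetric] ext_d_diff[OF K vH test_forms_H\<Lambda>[OF K \<phi>]])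
  have van: "vanishes_off K (a n)" "vanishes_off K (b n)" for n
  proof -
    have "a n \<in> L2\<Lambda> j K" "b n \<in> L2\<Lambda> (j + 1) K"
      unfolding a_def b_def using H\<Lambda>_L2\<Lambda>[OF vH] H\<Lambda>_ext_d(2)[OF K vH] test_forms_L2\<Lambda>[OF \<phi>] w(1)
      by (auto intro: subspace_diff subspace_L2\<Lambda>)
    then show "vanishes_off K (a n)" "vanishes_off K (b n)" by (auto simp: L2\<Lambda>_def)
  qed
  have "(\<lambda>n. form_inner K (a n) (a n) + form_inner K (b n) (b n)) \<longlonglongrightarrow> 0"
  proof (rule Lim_null_comparison)
    show "\<forall>\<^sub>F n in sequentially. norm (form_inner K (a n) (a n) + form_inner K (b n) (b n))
        \<le> (1 / real (Suc n))\<^sup>2"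
    proof (intro always_eventually allI)
      fix n
      let ?s = "form_inner K (a n) (a n) + form_inner K (b n) (b n)"
      have "sqrt ?s \<le> 1 / real (Suc n)" using lim[of n] unfolding ab_eq by linarith
      moreover have "0 \<le> ?s" by (intro add_nonneg_nonneg form_inner_nonneg)
      ultimately show "norm ?s \<le> (1 / real (Suc n))\<^sup>2"
        using power_mono[of "sqrt ?s" "1 / real (Suc n)" 2] by simp
    qed
    have "(\<lambda>n. (1 / real (Suc n))\<^sup>2) \<longlonglongrightarrow> 0\<^sup>2"
      by (intro tendsto_power LIMSEQ_Suc[OF lim_1_over_n])
    then show "(\<lambda>n. (1 / real (Suc n))\<^sup>2) \<longlonglongrightarrow> 0" by simp
  qed
  then have "(\<lambda>n. form_inner K (a n) (a n)) \<longlonglongrightarrow> 0" "(\<lambda>n. form_inner K (b n) (b n)) \<longlonglongrightarrow> 0"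
    by (rule Lim_null_comparison[rotated],
        intro always_eventually allI, simp add: form_inner_nonneg)+
  \<comment> \<open>The errors vanish off \<open>K\<close>, so their convergence on \<open>K\<close>
    is convergence on \<open>\<Omega>\<close>.\<close>
  then have "(\<lambda>n. form_inner \<Omega> (a n) (a n)) \<longlonglongrightarrow> 0" "(\<lambda>n. form_inner \<Omega> (b n) (b n)) \<longlonglongrightarrow> 0"
    by (simp_all add: form_inner_vanishes_off[OF sub K' \<Omega>'] van)
  note lims = this[THEN form_inner_tendsto_0[OF \<Omega>']]
  fix J \<psi> assume \<psi>: "test_fun \<Omega> \<psi>"
  \<comment> \<open>\<open>F x y\<close> is the defect of the identity \<open>y = dx\<close> on
    \<open>\<Omega>\<close>, tested with \<open>\<psi>\<close>. It is zero at the approximants, so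
    \<open>F (a n) (b n)\<close> is constantly the defect of the limit, and it also tends to
    0.\<close>
  define F where "F x y = form_inner \<Omega> y (monomial_form J \<psi>) + (\<Sum>i\<in>J. shuffle_sign {i} (J - {i}) *
      form_inner \<Omega> x (monomial_form (J - {i}) (partial_deriv i \<psi>)))" for x y
  have "F (\<phi> n) (w n) = 0" for n
    using w(2)[of n] \<psi> unfolding has_ext_d_iff[OF \<Omega>] F_def by simp
  moreover have "F (a n) (b n) = F v (ext_d K v) - F (\<phi> n) (w n)" for n
    by (simp add: F_def a_def b_def form_inner_diff_left[OF \<Omega>'] right_diff_distrib sum_subtractf)
  ultimately have "F (a n) (b n) = F v (ext_d K v)" for n by simp
  moreover have "(\<lambda>n. F (a n) (b n)) \<longlonglongrightarrow> 0 + (\<Sum>i\<in>J. shuffle_sign {i} (J - {i}) * 0)"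
    unfolding F_def by (intro tendsto_add tendsto_sum tendsto_mult tendsto_const lims)
  ultimately have "F v (ext_d K v) = 0" by (simp add: LIMSEQ_const_iff)
  then show "form_inner \<Omega> (ext_d K v) (monomial_form J \<psi>) =
      - (\<Sum>j\<in>J. shuffle_sign {j} (J - {j}) *
        form_inner \<Omega> v (monomial_form (J - {j}) (partial_deriv j \<psi>)))"
    by (simp add: F_def)
qed

lemma H0\<Lambda>_subset_H\<Lambda>:
  assumes K: "open K" and \<Omega>: "open \<Omega>" and sub: "K \<subseteq> \<Omega>" and v: "v \<in> H0\<Lambda> j K"
  shows "v \<in> H\<Lambda> j \<Omega>"
proof -
  have "v \<in> H\<Lambda> j K" using v by (simp add: H0\<Lambda>_def)
  then show ?thesis
    using H\<Lambda>_L2\<Lambda> H\<Lambda>_ext_d(2)[OF K] L2\<Lambda>_mono[OF sub] by (blast intro: H\<Lambda>_I H0\<Lambda>_has_ext_d[OF assms])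
qed

lemma H\<Lambda>_if_restr_H0\<Lambda>:
  assumes \<Omega>: "open \<Omega>" and T: "decomposition \<Omega> T" and v: "v \<in> L2\<Lambda> j \<Omega>"
    and H0: "\<And>K. K \<in> T \<Longrightarrow> restr K v \<in> H0\<Lambda> j K"
  shows "v \<in> H\<Lambda> j \<Omega>"
proof -
  have "vanishes_off \<Omega> v" using v by (simp add: L2\<Lambda>_def)
  then have "v = (\<Sum>K\<in>T. restr K v)" using sum_restr[OF T] by simp
  also have "\<dots> \<in> H\<Lambda> j \<Omega>"
    using H0\<Lambda>_subset_H\<Lambda>[OF decomposition_subdomain(1)[OF T] \<Omega> decomposition_subdomain(2)[OF T] H0]
    by (intro subspace_sum subspace_H\<Lambda> \<Omega>)
  finally show ?thesis .
qed

text \<open>Restrictions of the global derivative are the local derivatives, and they sum back to it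
  because the interfaces are null.\<close>

lemma broken_d_eq_ext_d:
  assumes \<Omega>: "open \<Omega>" and T: "decomposition \<Omega> T" and v: "v \<in> H\<Lambda> j \<Omega>"
  shows "broken_d T v = ext_d \<Omega> v"
proof -
  note K = decomposition_subdomain[OF T]
  have "broken_d T v = (\<Sum>K\<in>T. restr K (ext_d \<Omega> v))"
    unfolding broken_d_def using K
    by (intro sum.cong refl ext_d_eq has_ext_d_restr[OF _ \<Omega>] H\<Lambda>_ext_d(1)[OF \<Omega> v]) auto
  also have "\<dots> = ext_d \<Omega> v"
    using H\<Lambda>_ext_d(2)[OF \<Omega> v] by (intro sum_restr[OF T]) (simp add: L2\<Lambda>_def)
  finally show ?thesis .
qed

section \<open>Traces and their dual\<close>

lemma coset_eq_iff:
  fixes a b :: "'a::real_vector"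
  assumes S: "subspace S"
  shows "{a + z |z. z \<in> S} = {b + z |z. z \<in> S} \<longleftrightarrow> a - b \<in> S"
proof
  assume eq: "{a + z |z. z \<in> S} = {b + z |z. z \<in> S}"
  have "a \<in> {a + z |z. z \<in> S}" using subspace_0[OF S] by force
  with eq show "a - b \<in> S" by auto
next
  assume ab: "a - b \<in> S"
  have "{a + z |z. z \<in> S} \<subseteq> {b + z |z. z \<in> S}" if "a - b \<in> S" for a b
  proof clarify
    fix z assume "z \<in> S"
    then have "a - b + z \<in> S" by (rule subspace_add[OF S that])
    moreover have "a + z = b + (a - b + z)" by simp
    ultimately show "\<exists>y. a + z = b + y \<and> y \<in> S" by blast
  qed
  from this[OF ab] this[of b a] subspace_neg[OF S ab]
  show "{a + z |z. z \<in> S} = {b + z |z. z \<in> S}" by auto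
qed

lemma tan_trace_eq_iff:
  fixes T :: "'a::{finite,linorder} domain set"
  assumes T: "decomposition \<Omega> T"
  shows "tan_trace T j v = tan_trace T j w \<longleftrightarrow> (\<forall>K\<in>T. restr K (v - w) \<in> H0\<Lambda> j K)"
proof -
  note K = decomposition_subdomain[OF T]
  have restrict_eq: "restrict F T = restrict G T \<longleftrightarrow> (\<forall>K\<in>T. F K = G K)" for F G :: "'a trace"
    by (auto simp: restrict_def fun_eq_iff)
  have "tan_trace T j v = tan_trace T j w \<longleftrightarrow>
      (\<forall>K\<in>T. {restr K v + z |z. z \<in> H0\<Lambda> j K} = {restr K w + z |z. z \<in> H0\<Lambda> j K})"
    unfolding tan_trace_def restrict_eq ..
  also have "\<dots> \<longleftrightarrow> (\<forall>K\<in>T. restr K (v - w) \<in> H0\<Lambda> j K)"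
    by (intro ball_cong refl)
       (subst coset_eq_iff, simp_all add: K subspace_H0\<Lambda> restr_diff)
  finally show ?thesis .
qed

lemma trace_add_tan_trace:
  assumes T: "decomposition \<Omega> T"
  shows "trace_add T (tan_trace T j v) (tan_trace T j w) = tan_trace T j (v + w)"
  unfolding trace_add_def tan_trace_def
proof (rule restrict_ext)
  fix K assume KT: "K \<in> T"
  note K = decomposition_subdomain[OF T KT] and S = subspace_H0\<Lambda>[OF decomposition_subdomain(1)[OF T KT], of j]
  have "\<exists>z'. (restr K v + z) + (restr K w + y) = restr K (v + w) + z' \<and> z' \<in> H0\<Lambda> j K"
    if "z \<in> H0\<Lambda> j K" "y \<in> H0\<Lambda> j K" for z y
    using subspace_add[OF S that] by (intro exI[of _ "z + y"]) (simp add: restr_add K)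
  moreover have "\<exists>a b. restr K (v + w) + z = a + b \<and> (\<exists>z. a = restr K v + z \<and> z \<in> H0\<Lambda> j K) \<and>
      (\<exists>z. b = restr K w + z \<and> z \<in> H0\<Lambda> j K)" if "z \<in> H0\<Lambda> j K" for z
    using subspace_0[OF S] that
    by (intro exI[of _ "restr K v + z"] exI[of _ "restr K w + 0"]) (auto simp: restr_add K)
  ultimately show "{a + b |a b. a \<in> (\<lambda>K\<in>T. {restr K v + z |z. z \<in> H0\<Lambda> j K}) K \<and>
        b \<in> (\<lambda>K\<in>T. {restr K w + z |z. z \<in> H0\<Lambda> j K}) K}
      = {restr K (v + w) + z |z. z \<in> H0\<Lambda> j K}"
    using KT by auto
qed

text \<open>The summand from \<open>H0\<Lambda> j K\<close> in \<open>trace_scale\<close> matters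
  for \<open>c = 0\<close>: scaling alone would collapse a coset to a point instead of the zero
  coset.\<close>

lemma trace_scale_tan_trace:
  assumes T: "decomposition \<Omega> T"
  shows "trace_scale T j c (tan_trace T j v) = tan_trace T j (c *\<^sub>R v)"
  unfolding trace_scale_def tan_trace_def
proof (rule restrict_ext)
  fix K assume KT: "K \<in> T"
  note K = decomposition_subdomain[OF T KT] and S = subspace_H0\<Lambda>[OF decomposition_subdomain(1)[OF T KT], of j]
  have "\<exists>z'. c *\<^sub>R (restr K v + z) + y = restr K (c *\<^sub>R v) + z' \<and> z' \<in> H0\<Lambda> j K"
    if "z \<in> H0\<Lambda> j K" "y \<in> H0\<Lambda> j K" for z y
    using subspace_add[OF S subspace_scale[OF S that(1)] that(2)]
    by (intro exI[of _ "c *\<^sub>R z + y"]) (simp add: restr_scaleR K scaleR_add_right)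
  moreover have "\<exists>a y. restr K (c *\<^sub>R v) + z = c *\<^sub>R a + y \<and> (\<exists>z. a = restr K v + z \<and> z \<in> H0\<Lambda> j K) \<and>
      y \<in> H0\<Lambda> j K" if "z \<in> H0\<Lambda> j K" for z
    using subspace_0[OF S] that
    by (intro exI[of _ "restr K v + 0"] exI[of _ z]) (auto simp: restr_scaleR K)
  ultimately show "{c *\<^sub>R a + z |a z. a \<in> (\<lambda>K\<in>T. {restr K v + z |z. z \<in> H0\<Lambda> j K}) K \<and> z \<in> H0\<Lambda> j K}
      = {restr K (c *\<^sub>R v) + z |z. z \<in> H0\<Lambda> j K}"
    using KT by auto
qed

lemma trace_diff_tan_trace:
  assumes T: "decomposition \<Omega> T"
  shows "trace_diff T (tan_trace T j v) (tan_trace T j w) = tan_trace T j (v - w)"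
  unfolding trace_diff_def tan_trace_def
proof (rule restrict_ext)
  fix K assume KT: "K \<in> T"
  note K = decomposition_subdomain[OF T KT] and S = subspace_H0\<Lambda>[OF decomposition_subdomain(1)[OF T KT], of j]
  have "\<exists>z'. (restr K v + z) - (restr K w + y) = restr K (v - w) + z' \<and> z' \<in> H0\<Lambda> j K"
    if "z \<in> H0\<Lambda> j K" "y \<in> H0\<Lambda> j K" for z y
    using subspace_diff[OF S that] by (intro exI[of _ "z - y"]) (simp add: restr_diff K)
  moreover have "\<exists>a b. restr K (v - w) + z = a - b \<and> (\<exists>z. a = restr K v + z \<and> z \<in> H0\<Lambda> j K) \<and>
      (\<exists>z. b = restr K w + z \<and> z \<in> H0\<Lambda> j K)" if "z \<in> H0\<Lambda> j K" for z
    using subspace_0[OF S] that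
    by (intro exI[of _ "restr K v + z"] exI[of _ "restr K w + 0"]) (auto simp: restr_diff K)
  ultimately show "{a - b |a b. a \<in> (\<lambda>K\<in>T. {restr K v + z |z. z \<in> H0\<Lambda> j K}) K \<and>
        b \<in> (\<lambda>K\<in>T. {restr K w + z |z. z \<in> H0\<Lambda> j K}) K}
      = {restr K (v - w) + z |z. z \<in> H0\<Lambda> j K}"
    using KT by auto
qed

lemma trace_dual_tan_trace_zero:
  assumes T: "decomposition \<Omega> T" and S: "subspace S"
    and l: "l \<in> trace_dual T j (tan_trace T j ` S)"
  shows "l (tan_trace T j 0) = 0"
proof -
  have "l (trace_scale T j 0 (tan_trace T j 0)) = 0 * l (tan_trace T j 0)"
    using l subspace_0[OF S] unfolding trace_dual_def by blast
  then show ?thesis by (simp add: trace_scale_tan_trace[OF T])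
qed

text \<open>The universal property of a quotient: a linear functional vanishing on the forms of zero
  trace descends along the trace map.\<close>

lemma trace_dual_exists:
  assumes T: "decomposition \<Omega> T" and S: "subspace S"
    and add: "\<And>v w. v \<in> S \<Longrightarrow> w \<in> S \<Longrightarrow> L (v + w) = L v + L w"
    and scale: "\<And>c v. v \<in> S \<Longrightarrow> L (c *\<^sub>R v) = c * L v"
    and kernel: "\<And>v. v \<in> S \<Longrightarrow> (\<And>K. K \<in> T \<Longrightarrow> restr K v \<in> H0\<Lambda> j K) \<Longrightarrow> L v = 0"
  obtains l where "l \<in> trace_dual T j (tan_trace T j ` S)"
    and "\<And>v. v \<in> S \<Longrightarrow> l (tan_trace T j v) = (L v :: real)"
proof -
  \<comment> \<open>Two representatives of a trace differ by a form of zero trace, where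
    \<open>L\<close> vanishes, so the choice does not matter. Restricting to the trace space
    supplies extensionality.\<close>
  define l where "l = (\<lambda>A \<in> tan_trace T j ` S. L (SOME v. v \<in> S \<and> tan_trace T j v = A))"
  have l: "l (tan_trace T j v) = L v" if v: "v \<in> S" for v
  proof -
    define w where "w = (SOME w. w \<in> S \<and> tan_trace T j w = tan_trace T j v)"
    have "w \<in> S \<and> tan_trace T j w = tan_trace T j v"
      unfolding w_def by (rule someI[of _ v]) (use v in simp)
    then have w: "w \<in> S" "\<And>K. K \<in> T \<Longrightarrow> restr K (w - v) \<in> H0\<Lambda> j K"
      using tan_trace_eq_iff[OF T] by blast+
    have "L (w - v) = 0" using w v by (intro kernel subspace_diff[OF S]) auto
    moreover have "L w = L (w - v) + L v"
      using add[of "w - v" v] w v subspace_diff[OF S] by simp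
    ultimately show ?thesis using v by (simp add: l_def w_def)
  qed
  show ?thesis
  proof (rule that[OF _ l])
    have "l (trace_add T A B) = l A + l B"
      if "A \<in> tan_trace T j ` S" "B \<in> tan_trace T j ` S" for A B
      using that subspace_add[OF S] by (auto simp: trace_add_tan_trace[OF T] l add)
    moreover have "l (trace_scale T j c A) = c * l A" if "A \<in> tan_trace T j ` S" for c A
      using that subspace_scale[OF S] by (auto simp: trace_scale_tan_trace[OF T] l scale)
    ultimately show "l \<in> trace_dual T j (tan_trace T j ` S)"
      unfolding trace_dual_def by (simp add: l_def)
  qed
qed

text \<open>A basis of \<open>Z\<close> together with \<open>v\<close> stays independent, and a
  linear map may be prescribed on it. The argument is purely algebraic, as is the dual it
  serves.\<close>

lemma separating_functional:
  fixes v :: "'a::real_vector"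
  assumes Z: "subspace Z" and v: "v \<notin> Z"
  obtains L :: "'a \<Rightarrow> real" where "linear L" "L v = 1" "\<And>z. z \<in> Z \<Longrightarrow> L z = 0"
proof -
  obtain B where B: "B \<subseteq> Z" "independent B" "Z \<subseteq> span B"
    using maximal_independent_subset by metis
  have "span B \<subseteq> Z" using B(1) Z by (rule span_minimal)
  then have vB: "v \<notin> span B" using v by blast
  then have "independent (insert v B)" using B(2) by (rule independent_insertI)
  from linear_independent_extend[OF this, of "\<lambda>x. if x = v then 1 else 0"]
  obtain L :: "'a \<Rightarrow> real" where L: "linear L" "\<And>x. x \<in> insert v B \<Longrightarrow> L x = (if x = v then 1 else 0)"
    by blast
  have "v \<notin> B" using vB span_base by blast
  then have "L b = 0" if "b \<in> B" for b using that L(2)[of b] by auto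
  then have "L z = 0" if "z \<in> Z" for z
    using linear_eq_0_on_span[OF L(1), of B z] that B(3) by blast
  moreover have "L v = 1" using L(2)[of v] by simp
  ultimately show ?thesis using that[of L] L(1) by blast
qed

text \<open>\<open>?Z\<close> is the kernel of the trace map; a functional separating
  \<open>v\<close> from it descends to the traces and detects \<open>v\<close>.\<close>

lemma trace_dual_separates:
  assumes T: "decomposition \<Omega> T" and S: "subspace S" and v: "v \<in> S"
    and zero: "\<And>l. l \<in> trace_dual T j (tan_trace T j ` S) \<Longrightarrow> l (tan_trace T j v) = 0"
    and K: "K \<in> T"
  shows "restr K v \<in> H0\<Lambda> j K"
proof -
  let ?Z = "{w. \<forall>K\<in>T. restr K w \<in> H0\<Lambda> j K}"
  note sub = decomposition_subdomain[OF T]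
  have Z: "subspace ?Z"
    using subspace_H0\<Lambda>[OF sub(1)] sub
    by (intro subspaceI)
       (auto simp: restr_zero restr_add restr_scaleR subspace_0 subspace_add subspace_scale)
  have "v \<in> ?Z"
  proof (rule ccontr)
    assume "v \<notin> ?Z"
    then obtain L where L: "linear L" "L v = (1 :: real)" "\<And>z. z \<in> ?Z \<Longrightarrow> L z = 0"
      using separating_functional[OF Z] by blast
    obtain l where "l \<in> trace_dual T j (tan_trace T j ` S)" "\<And>v. v \<in> S \<Longrightarrow> l (tan_trace T j v) = L v"
      by (rule trace_dual_exists[OF T S, of L j]) (use L in \<open>auto simp: linear_add linear_cmul\<close>)
    with zero v L(2) show False by force
  qed
  then show ?thesis using K by blast
qed

section \<open>Broken and conforming discrete spaces\<close>

lemma subspace_Wh: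
  assumes T: "decomposition \<Omega> T" and W: "\<And>K. K \<in> T \<Longrightarrow> subspace (W K j)"
  shows "subspace (Wh \<Omega> T W j)"
  using decomposition_subdomain[OF T] W subspace_L2\<Lambda>[of j \<Omega>]
  unfolding Wh_def broken_space_def
  by (intro subspaceI) (auto simp: restr_zero restr_add restr_scaleR subspace_0 subspace_add subspace_scale)

text \<open>The difference \<open>v - w\<close> has zero trace on every subdomain and is therefore
  conforming; subtracting it from \<open>v\<close> leaves \<open>w\<close>.\<close>

lemma Vh_if_trace_eq:
  assumes \<Omega>: "open \<Omega>" and T: "decomposition \<Omega> T"
    and v: "v \<in> Vh \<Omega> T W j" and w: "w \<in> Wh \<Omega> T W j"
    and eq: "tan_trace T j v = tan_trace T j w"
  shows "w \<in> Vh \<Omega> T W j"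
proof -
  have "v - w \<in> H\<Lambda> j \<Omega>"
  proof (rule H\<Lambda>_if_restr_H0\<Lambda>[OF \<Omega> T])
    show "v - w \<in> L2\<Lambda> j \<Omega>"
      using v w by (intro subspace_diff subspace_L2\<Lambda>) (auto simp: Vh_def Wh_def broken_space_def)
    show "restr K (v - w) \<in> H0\<Lambda> j K" if "K \<in> T" for K
      using eq that tan_trace_eq_iff[OF T] by blast
  qed
  moreover have "v \<in> H\<Lambda> j \<Omega>" using v by (simp add: Vh_def)
  ultimately have "v - (v - w) \<in> H\<Lambda> j \<Omega>"
    by (intro subspace_diff[OF subspace_H\<Lambda>[OF \<Omega>], of v j "v - w"])
  then show ?thesis using w by (simp add: Vh_def)
qed

text \<open>On the kernel of the trace map the FEEC equations become available, exactly where the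
  factorization through traces demands a zero residual.\<close>

lemma Vh_if_restr_H0\<Lambda>:
  assumes \<Omega>: "open \<Omega>" and T: "decomposition \<Omega> T" and v: "v \<in> Wh \<Omega> T W j"
    and H0: "\<And>K. K \<in> T \<Longrightarrow> restr K v \<in> H0\<Lambda> j K"
  shows "v \<in> Vh \<Omega> T W j"
  using H\<Lambda>_if_restr_H0\<Lambda>[OF \<Omega> T _ H0] v by (auto simp: Vh_def Wh_def broken_space_def)

text \<open>Admits \<open>pb = 0\<close> as an unknown of the hybrid problem.\<close>

lemma zero_broken_harmonic:
  assumes T: "decomposition \<Omega> T" and W: "\<And>K. K \<in> T \<Longrightarrow> subspace (W K k)"
  shows "0 \<in> broken_harmonic \<Omega> T W k"
proof -
  note K = decomposition_subdomain[OF T]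
  have "0 \<in> local_harmonic W k K" if "K \<in> T" for K
    using K[OF that] W[OF that] subspace_H0\<Lambda>[OF K(1)[OF that], of k]
    by (auto simp: local_harmonic_def W0_def subspace_0 ext_d_zero)
  then show ?thesis
    using K subspace_0[OF subspace_L2\<Lambda>] by (auto simp: broken_harmonic_def broken_space_def restr_zero)
qed

text \<open>Linearity of \<open>ext_d\<close> rests on the existence of weak derivatives; membership
  in \<open>Wh\<close> provides this on each subdomain.\<close>

lemma broken_d_linear:
  assumes T: "decomposition \<Omega> T" and W: "\<And>K. K \<in> T \<Longrightarrow> W K j \<subseteq> H\<Lambda> j K"
    and v: "v \<in> Wh \<Omega> T W j"
  shows "w \<in> Wh \<Omega> T W j \<Longrightarrow> broken_d T (v + w) = broken_d T v + broken_d T w"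
    and "broken_d T (c *\<^sub>R v) = c *\<^sub>R broken_d T v"
proof -
  note K = decomposition_subdomain[OF T]
  have H: "restr K u \<in> H\<Lambda> j K" if "u \<in> Wh \<Omega> T W j" "K \<in> T" for u K
    using that W by (auto simp: Wh_def broken_space_def)
  show "broken_d T (v + w) = broken_d T v + broken_d T w" if "w \<in> Wh \<Omega> T W j"
    unfolding broken_d_def sum.distrib[symmetric]
  proof (rule sum.cong[OF refl])
    fix K assume "K \<in> T"
    then show "ext_d K (restr K (v + w)) = ext_d K (restr K v) + ext_d K (restr K w)"
      using ext_d_add[OF K(1) H[OF v] H[OF that]] by (simp add: restr_add K)
  qed
  show "broken_d T (c *\<^sub>R v) = c *\<^sub>R broken_d T v"
    unfolding broken_d_def scaleR_sum_right
  proof (rule sum.cong[OF refl])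
    fix K assume "K \<in> T"
    then show "ext_d K (restr K (c *\<^sub>R v)) = c *\<^sub>R ext_d K (restr K v)"
      using ext_d_scaleR[OF K(1) H[OF v]] by (simp add: restr_scaleR K)
  qed
qed

section \<open>Equivalence of the two problems\<close>

text \<open>Every element of the trace space is the trace of a test form, so (a) and (b) fix both
  functionals there; extensionality fixes them elsewhere.\<close>

lemma normal_pairs_unique:
  assumes "(un, rn) \<in> normal_pairs \<Omega> T W k f \<sigma> u pb p"
  shows "normal_pairs \<Omega> T W k f \<sigma> u pb p = {(un, rn)}"
proof -
  have "un' = un \<and> rn' = rn" if "(un', rn') \<in> normal_pairs \<Omega> T W k f \<sigma> u pb p" for un' rn'
  proof
    have "un' A = un A" if A: "A \<in> W_tan \<Omega> T W (k - 1)" for A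
    proof -
      from A obtain \<tau> where "\<tau> \<in> Wh \<Omega> T W (k - 1)" "A = tan_trace T (k - 1) \<tau>"
        by (auto simp: W_tan_def)
      then show ?thesis
        using assms \<open>(un', rn') \<in> _\<close> unfolding normal_pairs_def hybrid_a_def by fastforce
    qed
    then show "un' = un"
      using assms \<open>(un', rn') \<in> _\<close> unfolding normal_pairs_def W_nor_def trace_dual_def
      by (blast intro: extensionalityI)
    have "rn' A = rn A" if A: "A \<in> W_tan \<Omega> T W k" for A
    proof -
      from A obtain v where "v \<in> Wh \<Omega> T W k" "A = tan_trace T k v"
        by (auto simp: W_tan_def)
      then show ?thesis
        using assms \<open>(un', rn') \<in> _\<close> unfolding normal_pairs_def hybrid_b_def by fastforce
    qed
    then show "rn' = rn"
      using assms \<open>(un', rn') \<in> _\<close> unfolding normal_pairs_def W_nor_def trace_dual_def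
      by (blast intro: extensionalityI)
  qed
  then have "x = (un, rn)" if "x \<in> normal_pairs \<Omega> T W k f \<sigma> u pb p" for x
    using that by (metis prod.collapse)
  with assms show ?thesis by blast
qed

text \<open>The last conjunct is the existence half of unique determination: the equivalence alone
  would allow a FEEC solution that admits no normal traces.\<close>

theorem theorem4p2:
  fixes \<Omega> :: "'n::{finite,linorder} domain"
    and T :: "'n domain set"
    and W :: "'n local_spaces"
    and k :: int
    and f :: "'n form"
  assumes "bounded \<Omega>" and "lipschitz_domain \<Omega>"
    and "decomposition \<Omega> T"
    and "\<And>K. K \<in> T \<Longrightarrow> fd_subcomplex K (W K)"
    and "0 \<le> k" and "k \<le> int CARD('n)"
    and "f \<in> L2\<Lambda> k \<Omega>"
  shows "(\<forall>\<sigma> u pb un rn p ub st ut.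
            hybrid_solution \<Omega> T W k f \<sigma> u pb un rn p ub st ut \<longleftrightarrow>
              FEEC_solution \<Omega> T W k f \<sigma> u p \<and>
              pb = 0 \<and>
              normal_pairs \<Omega> T W k f \<sigma> u pb p = {(un, rn)} \<and>
              is_orth_proj T (broken_harmonic \<Omega> T W k) u ub \<and>
              st = tan_trace T (k - 1) \<sigma> \<and>
              ut = tan_trace T k u)
         \<and> (\<forall>\<sigma> u p. FEEC_solution \<Omega> T W k f \<sigma> u p \<longrightarrow>
              (\<exists>un rn. normal_pairs \<Omega> T W k f \<sigma> u 0 p = {(un, rn)}))"
proof -
  note T = assms(3)
  have \<Omega>: "open \<Omega>" by (rule lipschitz_domain_open[OF assms(2)])
  note \<Omega>' = open_sets_lebesgue[OF \<Omega>]
  have W: "subspace (W K j)" "W K j \<subseteq> H\<Lambda> j K" if "K \<in> T" for K j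
    using assms(4)[OF that] unfolding fd_subcomplex_def by blast+
  have Wh: "subspace (Wh \<Omega> T W j)" for j by (intro subspace_Wh[OF T] W)
  have Vh_Wh: "v \<in> Wh \<Omega> T W j" if "v \<in> Vh \<Omega> T W j" for v j
    using that by (simp add: Vh_def)
  \<comment> \<open>From here on broken inner products are global ones, and on conforming forms so
    are broken derivatives.\<close>
  have inner: "broken_inner T v w = form_inner \<Omega> v w" for v w
    by (rule form_inner_eq_broken_inner[OF T \<Omega>', symmetric])
  have d: "broken_d T v = ext_d \<Omega> v" if "v \<in> Vh \<Omega> T W j" for v j
    using that by (intro broken_d_eq_ext_d[OF \<Omega> T, of _ j]) (simp add: Vh_def)
  have harmonic_Vh: "p \<in> Vh \<Omega> T W k" if "p \<in> harmonic \<Omega> T W k" for p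
    using that by (simp add: harmonic_def)
  note linear = form_inner_add_left[OF \<Omega>'] form_inner_add_right[OF \<Omega>']
    form_inner_diff_left[OF \<Omega>'] form_inner_diff_right[OF \<Omega>']
    form_inner_scaleR_left[OF \<Omega>'] form_inner_scaleR_right[OF \<Omega>']
  \<comment> \<open>The common consequence of (d) and (e): all functionals vanish at the trace of a
    difference, which gives both conformity and equality of traces.\<close>
  have V_tan_iff: "w \<in> Vh \<Omega> T W j \<and> A = tan_trace T j w"
    if A: "A \<in> V_tan \<Omega> T W j" and w: "w \<in> Wh \<Omega> T W j"
      and zero: "\<And>l. l \<in> W_nor \<Omega> T W j \<Longrightarrow> l (trace_diff T A (tan_trace T j w)) = 0" for A w j
  proof -
    from A obtain v where v: "v \<in> Vh \<Omega> T W j" "A = tan_trace T j v"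
      by (auto simp: V_tan_def)
    have "v - w \<in> Wh \<Omega> T W j" using v w Vh_Wh by (intro subspace_diff[OF Wh]) auto
    then have "restr K (v - w) \<in> H0\<Lambda> j K" if "K \<in> T" for K
      using trace_dual_separates[OF T Wh _ _ that] zero
      unfolding v(2) trace_diff_tan_trace[OF T] W_nor_def W_tan_def by blast
    then have "tan_trace T j v = tan_trace T j w"
      unfolding tan_trace_eq_iff[OF T] by blast
    then show ?thesis using Vh_if_trace_eq[OF \<Omega> T v(1) w] v(2) by simp
  qed
  have fwd: "FEEC_solution \<Omega> T W k f \<sigma> u p \<and> pb = 0 \<and>
      normal_pairs \<Omega> T W k f \<sigma> u pb p = {(un, rn)} \<and>
      is_orth_proj T (broken_harmonic \<Omega> T W k) u ub \<and>
      st = tan_trace T (k - 1) \<sigma> \<and> ut = tan_trace T k u"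
    if sol: "hybrid_solution \<Omega> T W k f \<sigma> u pb un rn p ub st ut" for \<sigma> u pb un rn p ub st ut
  proof -
    have \<sigma>: "\<sigma> \<in> Vh \<Omega> T W (k - 1) \<and> st = tan_trace T (k - 1) \<sigma>"
      using sol by (intro V_tan_iff) (auto simp: hybrid_solution_def)
    have u: "u \<in> Vh \<Omega> T W k \<and> ut = tan_trace T k u"
      using sol by (intro V_tan_iff) (auto simp: hybrid_solution_def)
    have a: "form_inner \<Omega> \<sigma> \<tau> - form_inner \<Omega> u (broken_d T \<tau>) + un (tan_trace T (k - 1) \<tau>) = 0"
      if "\<tau> \<in> Wh \<Omega> T W (k - 1)" for \<tau>
      using sol that unfolding hybrid_solution_def hybrid_a_def inner by blast
    have b: "form_inner \<Omega> (broken_d T \<sigma>) v + form_inner \<Omega> (broken_d T u) (broken_d T v)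
        + form_inner \<Omega> (pb + p) v - rn (tan_trace T k v) = form_inner \<Omega> f v"
      if "v \<in> Wh \<Omega> T W k" for v
      using sol that unfolding hybrid_solution_def hybrid_b_def inner by blast
    \<comment> \<open>Membership in \<open>broken_harmonic\<close> makes \<open>pb\<close>
      admissible in (g) and places it in \<open>L2\<Lambda> k \<Omega>\<close>, where the inner
      product is definite.\<close>
    have pb: "pb = 0"
    proof -
      have "pb \<in> broken_harmonic \<Omega> T W k" "form_inner \<Omega> pb pb = 0"
        using sol unfolding hybrid_solution_def inner by blast+
      then show ?thesis
        by (intro form_inner_self_eq_0[OF \<Omega>'])
           (auto simp: broken_harmonic_def broken_space_def L2\<Lambda>_def)
    qed
    have "FEEC_solution \<Omega> T W k f \<sigma> u p"
      unfolding FEEC_solution_def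
    proof (intro conjI ballI)
      show "form_inner \<Omega> \<sigma> \<tau> - form_inner \<Omega> u (ext_d \<Omega> \<tau>) = 0" if \<tau>: "\<tau> \<in> Vh \<Omega> T W (k - 1)" for \<tau>
      proof -
        have "un (tan_trace T (k - 1) \<tau>) = 0"
          using sol \<tau> unfolding hybrid_solution_def V_tan_def by blast
        then show ?thesis using a[OF Vh_Wh[OF \<tau>]] d[OF \<tau>] by simp
      qed
      show "form_inner \<Omega> (ext_d \<Omega> \<sigma>) v + form_inner \<Omega> (ext_d \<Omega> u) (ext_d \<Omega> v) + form_inner \<Omega> p v
          = form_inner \<Omega> f v" if v: "v \<in> Vh \<Omega> T W k" for v
      proof -
        have "rn (tan_trace T k v) = 0"
          using sol v unfolding hybrid_solution_def V_tan_def by blast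
        then show ?thesis using b[OF Vh_Wh[OF v]] d[OF v] d[OF conjunct1[OF \<sigma>]] d[OF conjunct1[OF u]] pb by simp
      qed
    qed (use sol \<sigma> u in \<open>auto simp: hybrid_solution_def inner\<close>)
    moreover have "(un, rn) \<in> normal_pairs \<Omega> T W k f \<sigma> u pb p"
      using sol unfolding hybrid_solution_def normal_pairs_def by blast
    moreover have "is_orth_proj T (broken_harmonic \<Omega> T W k) u ub"
      using sol by (auto simp: hybrid_solution_def is_orth_proj_def inner linear)
    ultimately show ?thesis using \<sigma> u pb normal_pairs_unique by blast
  qed
  have bwd: "hybrid_solution \<Omega> T W k f \<sigma> u pb un rn p ub st ut"
    if FEEC: "FEEC_solution \<Omega> T W k f \<sigma> u p" and pb: "pb = 0"
      and pairs: "normal_pairs \<Omega> T W k f \<sigma> u pb p = {(un, rn)}"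
      and proj: "is_orth_proj T (broken_harmonic \<Omega> T W k) u ub"
      and st: "st = tan_trace T (k - 1) \<sigma>" and ut: "ut = tan_trace T k u"
    for \<sigma> u pb un rn p ub st ut
  proof -
    have \<sigma>: "\<sigma> \<in> Vh \<Omega> T W (k - 1)" and u: "u \<in> Vh \<Omega> T W k" and p: "p \<in> harmonic \<Omega> T W k"
      using FEEC by (auto simp: FEEC_solution_def)
    have un: "un \<in> W_nor \<Omega> T W (k - 1)" and rn: "rn \<in> W_nor \<Omega> T W k"
      and a: "hybrid_a \<Omega> T W k \<sigma> u un" and b: "hybrid_b \<Omega> T W k f \<sigma> u pb p rn"
      using pairs unfolding normal_pairs_def by blast+
    \<comment> \<open>With \<open>st\<close> and \<open>ut\<close> equal to the actual traces, (d)
      and (e) evaluate a functional at the trace of 0.\<close>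
    have diff: "l (trace_diff T (tan_trace T j v) (tan_trace T j v)) = 0"
      if "l \<in> W_nor \<Omega> T W j" for l v j
      using trace_dual_tan_trace_zero[OF T Wh] that
      by (simp add: trace_diff_tan_trace[OF T] W_nor_def W_tan_def)
    \<comment> \<open>Subtracting the FEEC equation from (a), tested with a conforming form, leaves
      (h); (i) comes from (b) in the same way, using \<open>pb = 0\<close>.\<close>
    have h: "un \<tau> = 0" if "\<tau> \<in> V_tan \<Omega> T W (k - 1)" for \<tau>
    proof -
      from that obtain t where t: "t \<in> Vh \<Omega> T W (k - 1)" "\<tau> = tan_trace T (k - 1) t"
        by (auto simp: V_tan_def)
      have "form_inner \<Omega> \<sigma> t - form_inner \<Omega> u (ext_d \<Omega> t) + un \<tau> = 0"
        using a Vh_Wh[OF t(1)] unfolding hybrid_a_def inner t(2) d[OF t(1), symmetric] by blast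
      moreover have "form_inner \<Omega> \<sigma> t - form_inner \<Omega> u (ext_d \<Omega> t) = 0"
        using FEEC t(1) unfolding FEEC_solution_def by blast
      ultimately show ?thesis by simp
    qed
    have i: "rn A = 0" if "A \<in> V_tan \<Omega> T W k" for A
    proof -
      from that obtain v where v: "v \<in> Vh \<Omega> T W k" "A = tan_trace T k v"
        by (auto simp: V_tan_def)
      have "form_inner \<Omega> (ext_d \<Omega> \<sigma>) v + form_inner \<Omega> (ext_d \<Omega> u) (ext_d \<Omega> v)
          + form_inner \<Omega> (pb + p) v - rn A = form_inner \<Omega> f v"
        using b Vh_Wh[OF v(1)]
        unfolding hybrid_b_def inner v(2) d[OF v(1), symmetric] d[OF \<sigma>, symmetric] d[OF u, symmetric]
        by blast
      moreover have "form_inner \<Omega> (ext_d \<Omega> \<sigma>) v + form_inner \<Omega> (ext_d \<Omega> u) (ext_d \<Omega> v)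
          + form_inner \<Omega> p v = form_inner \<Omega> f v"
        using FEEC v(1) unfolding FEEC_solution_def by blast
      ultimately show ?thesis using pb by simp
    qed
    show ?thesis
      unfolding hybrid_solution_def
    proof (intro conjI ballI)
      show "pb \<in> broken_harmonic \<Omega> T W k"
        unfolding pb by (intro zero_broken_harmonic[OF T] W)
      show "broken_inner T (ub - u) q = 0" if "q \<in> broken_harmonic \<Omega> T W k" for q
        using proj that by (auto simp: is_orth_proj_def inner linear)
      show "broken_inner T u q = 0" if "q \<in> harmonic \<Omega> T W k" for q
        using FEEC that by (simp add: FEEC_solution_def inner)
      show "broken_inner T pb v = 0" for v
        using \<Omega>' by (simp add: pb inner)
    qed (use \<sigma> u p un rn a b h i proj Vh_Wh diff in \<open>auto simp: st ut V_tan_def is_orth_proj_def\<close>)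
  qed
  have exist: "\<exists>un rn. normal_pairs \<Omega> T W k f \<sigma> u 0 p = {(un, rn)}"
    if FEEC: "FEEC_solution \<Omega> T W k f \<sigma> u p" for \<sigma> u p
  proof -
    have \<sigma>: "\<sigma> \<in> Vh \<Omega> T W (k - 1)" and u: "u \<in> Vh \<Omega> T W k"
      using FEEC by (auto simp: FEEC_solution_def)
    have d_add: "broken_d T (v + w) = broken_d T v + broken_d T w"
      if "v \<in> Wh \<Omega> T W j" "w \<in> Wh \<Omega> T W j" for v w j
      using broken_d_linear(1)[OF T _ that] W(2) by blast
    have d_scale: "broken_d T (c *\<^sub>R v) = c *\<^sub>R broken_d T v" if "v \<in> Wh \<Omega> T W j" for c v j
      using broken_d_linear(2)[OF T _ that] W(2) by blast
    \<comment> \<open>\<open>un\<close> enters (a) with a plus sign, so it has to equal the negative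
      of the remaining terms.\<close>
    define L where "L \<tau> = form_inner \<Omega> u (broken_d T \<tau>) - form_inner \<Omega> \<sigma> \<tau>" for \<tau>
    obtain un where un: "un \<in> trace_dual T (k - 1) (tan_trace T (k - 1) ` Wh \<Omega> T W (k - 1))"
      "\<And>\<tau>. \<tau> \<in> Wh \<Omega> T W (k - 1) \<Longrightarrow> un (tan_trace T (k - 1) \<tau>) = L \<tau>"
    proof (rule trace_dual_exists[OF T Wh[of "k - 1"], of L "k - 1"])
      show "L (v + w) = L v + L w" if "v \<in> Wh \<Omega> T W (k - 1)" "w \<in> Wh \<Omega> T W (k - 1)" for v w
        using that by (simp add: L_def d_add[OF that] linear)
      show "L (c *\<^sub>R v) = c * L v" if "v \<in> Wh \<Omega> T W (k - 1)" for c v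
        using that by (simp add: L_def d_scale[OF that] linear right_diff_distrib)
      show "L v = 0" if "v \<in> Wh \<Omega> T W (k - 1)" "\<And>K. K \<in> T \<Longrightarrow> restr K v \<in> H0\<Lambda> (k - 1) K" for v
      proof -
        have v: "v \<in> Vh \<Omega> T W (k - 1)" using that by (rule Vh_if_restr_H0\<Lambda>[OF \<Omega> T])
        then show ?thesis using FEEC by (simp add: L_def FEEC_solution_def d[OF v])
      qed
    qed blast
    \<comment> \<open>\<open>rn\<close> enters (b) with a minus sign, so here the residual is left
      side minus right side, with \<open>pb\<close> set to 0.\<close>
    define R where "R v = form_inner \<Omega> (broken_d T \<sigma>) v + form_inner \<Omega> (broken_d T u) (broken_d T v)
        + form_inner \<Omega> p v - form_inner \<Omega> f v" for v
    obtain rn where rn: "rn \<in> trace_dual T k (tan_trace T k ` Wh \<Omega> T W k)"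
      "\<And>v. v \<in> Wh \<Omega> T W k \<Longrightarrow> rn (tan_trace T k v) = R v"
    proof (rule trace_dual_exists[OF T Wh[of k], of R k])
      show "R (v + w) = R v + R w" if "v \<in> Wh \<Omega> T W k" "w \<in> Wh \<Omega> T W k" for v w
        using that by (simp add: R_def d_add[OF that] linear)
      show "R (c *\<^sub>R v) = c * R v" if "v \<in> Wh \<Omega> T W k" for c v
        using that by (simp add: R_def d_scale[OF that] linear right_diff_distrib distrib_left)
      show "R v = 0" if "v \<in> Wh \<Omega> T W k" "\<And>K. K \<in> T \<Longrightarrow> restr K v \<in> H0\<Lambda> k K" for v
      proof -
        have v: "v \<in> Vh \<Omega> T W k" using that by (rule Vh_if_restr_H0\<Lambda>[OF \<Omega> T])
        then show ?thesis using FEEC by (simp add: R_def FEEC_solution_def d[OF \<sigma>] d[OF u] d[OF v])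
      qed
    qed blast
    have "(un, rn) \<in> normal_pairs \<Omega> T W k f \<sigma> u 0 p"
      using un rn
      by (simp add: normal_pairs_def W_nor_def W_tan_def hybrid_a_def hybrid_b_def inner L_def R_def)
    then show ?thesis using normal_pairs_unique by blast
  qed
  have equiv: "hybrid_solution \<Omega> T W k f \<sigma> u pb un rn p ub st ut \<longleftrightarrow>
      FEEC_solution \<Omega> T W k f \<sigma> u p \<and> pb = 0 \<and>
      normal_pairs \<Omega> T W k f \<sigma> u pb p = {(un, rn)} \<and>
      is_orth_proj T (broken_harmonic \<Omega> T W k) u ub \<and>
      st = tan_trace T (k - 1) \<sigma> \<and> ut = tan_trace T k u" for \<sigma> u pb un rn p ub st ut
    by (rule iffI, erule fwd, elim conjE, rule bwd)
  show ?thesis by (intro conjI allI impI equiv exist)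
qed

end
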